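(* Let $k$ be either a finitely generated field of characteristic $0$, or a finite transcendental extension of a field of characteristic $0$. Then for each $n\in\{0,1,2,3,5,7,9,15,27\}$ there exists a smooth cubic surface over $k$ containing exactly $n$ lines defined over $k$.
   Context: A line on a smooth cubic surface $X$ over $k$ is defined over $k$ if it is a line $L\subset\mathbb{P}^3_k$ (cut out by linear forms with coefficients in $k$) with $L\subseteq X$ as schemes. *)

theory Defs
  imports "HOL-Algebra.Algebraic_Closure_Type"
begin

definition is_subfield :: "'a::field set \<Rightarrow> bool" where
  "is_subfield K \<longleftrightarrow> 0 \<in> K \<and> 1 \<in> K \<and>
     (\<forall>x\<in>K. \<forall>y\<in>K. x + y \<in> K \<and> x * y \<in> K) \<and>
     (\<forall>x\<in>K. - x \<in> K \<and> inverse x \<in> K)"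

definition gen_subfield :: "'a::field set \<Rightarrow> 'a set" where
  "gen_subfield S = \<Inter>{K. is_subfield K \<and> S \<subseteq> K}"

definition finitely_generated_field :: "'a::field itself \<Rightarrow> bool" where
  "finitely_generated_field _ \<longleftrightarrow>
     (\<exists>S::'a set. finite S \<and> gen_subfield S = UNIV)"

definition algebraic_over :: "'a::field set \<Rightarrow> 'a \<Rightarrow> bool" where
  "algebraic_over K t \<longleftrightarrow>
     (\<exists>p::'a poly. p \<noteq> 0 \<and> (\<forall>i. coeff p i \<in> K) \<and> poly p t = 0)"

text \<open>The field (the whole type) is a finite (i.e. finitely generated) transcendental
  extension of some subfield K.  Since the whole field has characteristic 0 (type class
  field_char_0 in the theorem), so does K.\<close>
definition finite_transcendental_extension :: "'a::field itself \<Rightarrow> bool" where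
  "finite_transcendental_extension _ \<longleftrightarrow>
     (\<exists>K::'a set. is_subfield K \<and>
        (\<exists>S. finite S \<and> gen_subfield (K \<union> S) = UNIV) \<and>
        (\<exists>t. \<not> algebraic_over K t))"

text \<open>Points of affine 4-space are functions nat \<Rightarrow> field, only indices 0..3 matter.
  A cubic form F(x_0,..,x_3) = sum over i\<le>j\<le>l<4 of c(i,j,l) x_i x_j x_l is
  given by its coefficient function c on the monomial index set.\<close>

definition cubic_monos :: "(nat \<times> nat \<times> nat) set" where
  "cubic_monos = {(i, j, l). i \<le> j \<and> j \<le> l \<and> l < 4}"

definition cubic_eval ::
  "('a \<Rightarrow> 'b::comm_ring_1) \<Rightarrow> (nat \<times> nat \<times> nat \<Rightarrow> 'a) \<Rightarrow> (nat \<Rightarrow> 'b) \<Rightarrow> 'b" where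
  "cubic_eval phi c x =
     (\<Sum>(i, j, l)\<in>cubic_monos. phi (c (i, j, l)) * x i * x j * x l)"

definition cubic_partial ::
  "('a \<Rightarrow> 'b::comm_ring_1) \<Rightarrow> (nat \<times> nat \<times> nat \<Rightarrow> 'a) \<Rightarrow> nat \<Rightarrow> (nat \<Rightarrow> 'b) \<Rightarrow> 'b" where
  "cubic_partial phi c m x =
     (\<Sum>(i, j, l)\<in>cubic_monos. phi (c (i, j, l)) *
        ((if m = i then x j * x l else 0) + (if m = j then x i * x l else 0)
         + (if m = l then x i * x j else 0)))"

text \<open>X = V(F) is a smooth cubic surface: F is a nonzero cubic form and (Jacobian
  criterion) there is no geometric point, i.e. no nonzero point over the algebraic
  closure, at which F and all its partial derivatives vanish.\<close>
definition smooth_cubic_surface :: "(nat \<times> nat \<times> nat \<Rightarrow> 'a::field) \<Rightarrow> bool" where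
  "smooth_cubic_surface c \<longleftrightarrow>
     (\<exists>e\<in>cubic_monos. c e \<noteq> 0) \<and>
     \<not> (\<exists>x :: nat \<Rightarrow> 'a alg_closure. (\<exists>i<4. x i \<noteq> 0) \<and>
          cubic_eval to_ac c x = 0 \<and> (\<forall>m<4. cubic_partial to_ac c m x = 0))"

definition vec4 :: "(nat \<Rightarrow> 'a::zero) \<Rightarrow> bool" where
  "vec4 p \<longleftrightarrow> (\<forall>i\<ge>4. p i = 0)"

definition lin_indep2 :: "(nat \<Rightarrow> 'a::field) \<Rightarrow> (nat \<Rightarrow> 'a) \<Rightarrow> bool" where
  "lin_indep2 p q \<longleftrightarrow> (\<forall>a b. (\<forall>i. a * p i + b * q i = 0) \<longrightarrow> a = 0 \<and> b = 0)"

definition span2 :: "(nat \<Rightarrow> 'a::field) \<Rightarrow> (nat \<Rightarrow> 'a) \<Rightarrow> (nat \<Rightarrow> 'a) set" where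
  "span2 p q = {x. \<exists>s t. x = (\<lambda>i. s * p i + t * q i)}"

text \<open>A line of P^3 defined over k is identified with its 2-dimensional k-subspace
  of k^4.  It lies on X = V(F) (as schemes) iff F vanishes identically on the line,
  i.e. F(s p + t q) is the zero binary form; this is checked at all points over the
  (infinite) algebraic closure.\<close>
definition line_on_surface ::
  "(nat \<times> nat \<times> nat \<Rightarrow> 'a::field) \<Rightarrow> (nat \<Rightarrow> 'a) set \<Rightarrow> bool" where
  "line_on_surface c L \<longleftrightarrow>
     (\<exists>p q. vec4 p \<and> vec4 q \<and> lin_indep2 p q \<and> L = span2 p q \<and>
        (\<forall>s t :: 'a alg_closure.
            cubic_eval to_ac c (\<lambda>i. s * to_ac (p i) + t * to_ac (q i)) = 0))"

end

theory Submission
  imports Defs "Jordan_Normal_Form.Determinant"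
begin

text \<open>A field as in the theorem has, for every \<open>q \<ge> 2\<close>, an element \<open>a\<close> such that neither \<open>a\<close> nor \<open>-a\<close> is a
  \<open>q\<close>-th power. It is finite of some degree \<open>n\<close> over \<open>\<rat>\<close> or over a rational function field \<open>K(s)\<close>; put
  \<open>\<tau> = 2\<close> or \<open>\<tau> = s\<close>. If there were no such \<open>a\<close>, extracting \<open>q\<close>-th roots up to sign repeatedly would give
  \<open>x\<close> with \<open>x^N = \<plusminus>\<tau>\<close> and \<open>N = q^n > n\<close>, and the norm \<open>y\<close> of \<open>x\<close> would satisfy \<open>y^N = \<plusminus>\<tau>^n\<close>, which the
  \<open>2\<close>-adic valuation or the degree in \<open>s\<close> excludes.

  For \<open>n \<ge> 2\<close> let \<open>p = X C(X^2) + D(X^2)\<close> be a monic quintic with simple roots such that \<open>C\<close> and \<open>D\<close> have no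
  common root. With \<open>C\<close> and \<open>D\<close> made homogeneous in \<open>z, w\<close>, the surface
  \<open>z y^2 - w x^2 + x C + y D = 0\<close> is smooth, and its rational lines are \<open>z = w = 0\<close>, \<open>x = y = 0\<close>, three lines
  for each rational root of \<open>p\<close>, and one for each rational monic quadratic factor of \<open>p\<close>. Suitable products
  of \<open>(X - i)^2 - a\<close>, \<open>(X - 1)^4 - a\<close>, \<open>X^3 - c\<close>, \<open>X^5 - d\<close> and linear factors realise all required numbers.
  For \<open>n = 0\<close> the surface meets the rational plane \<open>w = 0\<close> in the zeros of an anisotropic norm form, and
  for \<open>n = 1\<close> an explicit equation is used.\<close>

section \<open>Elements that are not powers\<close>

lemma is_subfieldD:
  assumes "is_subfield K"
  shows "0 \<in> K" "1 \<in> K" "x \<in> K \<Longrightarrow> y \<in> K \<Longrightarrow> x + y \<in> K" "x \<in> K \<Longrightarrow> y \<in> K \<Longrightarrow> x * y \<in> K"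
    "x \<in> K \<Longrightarrow> - x \<in> K" "x \<in> K \<Longrightarrow> inverse x \<in> K" "x \<in> K \<Longrightarrow> y \<in> K \<Longrightarrow> x / y \<in> K"
    "x \<in> K \<Longrightarrow> y \<in> K \<Longrightarrow> x - y \<in> K"
  using assms unfolding is_subfield_def divide_inverse diff_conv_add_uminus by blast+

lemma is_subfield_sum:
  assumes "is_subfield K" "\<And>i. i \<in> A \<Longrightarrow> f i \<in> K"
  shows "sum f A \<in> K"
  using assms(2) by (induction A rule: infinite_finite_induct) (auto intro: is_subfieldD[OF assms(1)])

lemma is_subfield_prod:
  assumes "is_subfield K" "\<And>i. i \<in> A \<Longrightarrow> f i \<in> K"
  shows "prod f A \<in> K"
  using assms(2) by (induction A rule: infinite_finite_induct) (auto intro: is_subfieldD[OF assms(1)])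

lemma is_subfield_gen_subfield: "is_subfield (gen_subfield S)"
  unfolding gen_subfield_def is_subfield_def by blast

lemma gen_subfield_incl: "S \<subseteq> gen_subfield S"
  unfolding gen_subfield_def by blast

lemma gen_subfield_least: "is_subfield K \<Longrightarrow> S \<subseteq> K \<Longrightarrow> gen_subfield S \<subseteq> K"
  unfolding gen_subfield_def by blast

section \<open>The norm of a finite extension\<close>

definition spans_over :: "'a::field set \<Rightarrow> (nat \<Rightarrow> 'a) \<Rightarrow> nat \<Rightarrow> bool" where
  "spans_over K b n \<longleftrightarrow> (\<forall>x. \<exists>c. (\<forall>i<n. c i \<in> K) \<and> x = (\<Sum>i<n. c i * b i))"

definition finite_dim_over :: "'a::field set \<Rightarrow> bool" where
  "finite_dim_over K \<longleftrightarrow> (\<exists>n b. spans_over K b n)"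

text \<open>Two different expansions give a linear relation in which some \<open>b i\<close> has a
  nonzero coefficient. Solving it for \<open>b i\<close> yields a spanning family shorter by one. So
  a spanning family of least length behaves as a basis.\<close>

lemma minimal_span_unique:
  assumes K: "is_subfield K" and sp: "spans_over K b n"
    and minimal: "\<And>m b'. spans_over K b' m \<Longrightarrow> n \<le> m"
    and c: "\<And>i. i < n \<Longrightarrow> c i \<in> K" "\<And>i. i < n \<Longrightarrow> d i \<in> K"
    and eq: "(\<Sum>i<n. c i * b i) = (\<Sum>i<n. d i * b i)" and i: "i < n"
  shows "c i = d i"
proof (rule ccontr)
  assume ne: "c i \<noteq> d i"
  \<comment> \<open>The relation between the two expansions, scaled so that \<open>b i\<close> has
    coefficient \<open>-1\<close>.\<close>
  define e where "e j = (d j - c j) / (c i - d i)" for j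
  define b' where "b' j = b (if j < i then j else Suc j)" for j
  have split: "(\<Sum>j<n. f j) = f i + (\<Sum>j<n-1. f (if j < i then j else Suc j))" for f :: "nat \<Rightarrow> 'a"
  proof -
    have "(\<Sum>j<n. f j) = f i + (\<Sum>j\<in>{..<n}-{i}. f j)"
      using i by (simp add: sum.remove)
    also have "(\<Sum>j\<in>{..<n}-{i}. f j) = (\<Sum>j<n-1. f (if j < i then j else Suc j))"
      by (rule sum.reindex_bij_witness[of _ "\<lambda>j. if j < i then j else Suc j" "\<lambda>j. if j < i then j else j - 1"])
        (use i in auto)
    finally show ?thesis .
  qed
  have eK: "e j \<in> K" if "j < n" for j
    unfolding e_def using c that i by (intro is_subfieldD[OF K]) auto
  have "(\<Sum>j<n. (d j - c j) * b j) = 0"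
    using eq by (simp add: algebra_simps sum_subtractf)
  hence "(\<Sum>j<n. e j * b j) = 0"
    by (simp add: e_def sum_divide_distrib[symmetric])
  moreover have "e i = -1"
    using ne by (simp add: e_def divide_eq_eq)
  ultimately have bi: "b i = (\<Sum>j<n-1. e (if j < i then j else Suc j) * b' j)"
    using split[of "\<lambda>j. e j * b j"] by (simp add: b'_def)
  have "spans_over K b' (n - 1)"
    unfolding spans_over_def
  proof
    fix x
    obtain a where a: "\<forall>j<n. a j \<in> K" "x = (\<Sum>j<n. a j * b j)"
      using sp unfolding spans_over_def by blast
    have "x = (\<Sum>j<n-1. (a i * e (if j < i then j else Suc j) + a (if j < i then j else Suc j)) * b' j)"
      unfolding a(2) split[of "\<lambda>j. a j * b j"] bi
      by (simp add: b'_def sum_distrib_left algebra_simps sum.distrib)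
    moreover have "\<forall>j<n-1. a i * e (if j < i then j else Suc j) + a (if j < i then j else Suc j) \<in> K"
      using a(1) i eK by (auto intro!: is_subfieldD[OF K])
    ultimately show "\<exists>c. (\<forall>i<n - 1. c i \<in> K) \<and> x = (\<Sum>i<n - 1. c i * b' i)"
      by (intro exI[of _ "\<lambda>j. a i * e (if j < i then j else Suc j) + a (if j < i then j else Suc j)"]) blast
  qed
  from minimal[OF this] i show False by simp
qed

text \<open>\<open>N x\<close> is the determinant of multiplication by \<open>x\<close> in a basis
  over \<open>K\<close>. The listed properties suffice to push an equation for a power of
  \<open>x\<close> down to \<open>K\<close>.\<close>

lemma finite_dim_norm:
  fixes K :: "'a::field set"
  assumes K: "is_subfield K" and fd: "finite_dim_over K"
  obtains N :: "'a \<Rightarrow> 'a" and n :: nat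
  where "n > 0" "\<And>x. N x \<in> K" "\<And>x y. N (x * y) = N x * N y" "N 1 = 1"
    "\<And>x. x \<in> K \<Longrightarrow> N x = x ^ n"
proof -
  define n where "n = (LEAST n. \<exists>b. spans_over K b n)"
  have "\<exists>b. spans_over K b n"
    unfolding n_def using fd[unfolded finite_dim_over_def] by (rule LeastI_ex)
  then obtain b where sp: "spans_over K b n" by blast
  have minimal: "n \<le> m" if "spans_over K b' m" for m b'
    unfolding n_def by (rule Least_le) (use that in blast)
  note uniq = minimal_span_unique[OF K sp minimal]
  have "\<exists>c. (\<forall>i<n. c i \<in> K) \<and> x = (\<Sum>i<n. c i * b i)" for x
    using sp unfolding spans_over_def by blast
  then obtain c where cK: "\<And>x i. i < n \<Longrightarrow> c x i \<in> K" and c: "\<And>x. x = (\<Sum>i<n. c x i * b i)"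
    by metis
  have ceq: "c x i = d i" if "\<And>i. i < n \<Longrightarrow> d i \<in> K" "x = (\<Sum>i<n. d i * b i)" "i < n" for x d i
    by (rule uniq) (use that cK c[of x] in auto)
  \<comment> \<open>Column \<open>j\<close> holds the coordinates of \<open>x * b j\<close>, so this
    is the matrix of multiplication by \<open>x\<close>.\<close>
  define M where "M x = mat n n (\<lambda>(i, j). c (x * b j) i)" for x
  have Mdim: "M x \<in> carrier_mat n n" for x by (simp add: M_def)
  have Mprod: "M (x * y) = M x * M y" for x y
  proof (rule eq_matI)
    fix i j assume ij: "i < dim_row (M x * M y)" "j < dim_col (M x * M y)"
    hence i: "i < n" and j: "j < n" by (simp_all add: M_def)
    have "(M x * M y) $$ (i, j) = (\<Sum>l<n. c (x * b l) i * c (y * b j) l)"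
      using i j by (simp add: M_def scalar_prod_def lessThan_atLeast0)
    moreover have "c (x * y * b j) i = (\<Sum>l<n. c (x * b l) i * c (y * b j) l)"
    proof (rule ceq[OF _ _ i])
      show "(\<Sum>l<n. c (x * b l) i * c (y * b j) l) \<in> K" if "i < n" for i
        by (intro is_subfield_sum[OF K] is_subfieldD[OF K] cK that) auto
      have "x * y * b j = x * (\<Sum>l<n. c (y * b j) l * b l)"
        using c[of "y * b j"] by (simp add: mult.assoc)
      also have "\<dots> = (\<Sum>l<n. c (y * b j) l * (x * b l))"
        by (simp add: sum_distrib_left algebra_simps)
      also have "\<dots> = (\<Sum>l<n. c (y * b j) l * (\<Sum>i<n. c (x * b l) i * b i))"
        using c by simp
      also have "\<dots> = (\<Sum>l<n. \<Sum>i<n. c (x * b l) i * c (y * b j) l * b i)"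
        by (simp add: sum_distrib_left algebra_simps)
      also have "\<dots> = (\<Sum>i<n. \<Sum>l<n. c (x * b l) i * c (y * b j) l * b i)"
        by (rule sum.swap)
      finally show "x * y * b j = (\<Sum>i<n. (\<Sum>l<n. c (x * b l) i * c (y * b j) l) * b i)"
        by (simp add: sum_distrib_right)
    qed
    ultimately show "M (x * y) $$ (i, j) = (M x * M y) $$ (i, j)"
      using i j by (simp add: M_def)
  qed (simp_all add: M_def)
  have Mscalar: "M x = x \<cdot>\<^sub>m 1\<^sub>m n" if "x \<in> K" for x
  proof (rule eq_matI)
    fix i j assume ij: "i < dim_row (x \<cdot>\<^sub>m 1\<^sub>m n)" "j < dim_col (x \<cdot>\<^sub>m 1\<^sub>m n)"
    hence i: "i < n" and j: "j < n" by simp_all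
    have delta: "(\<Sum>i<n. (if i = j then x else 0) * b i) = (\<Sum>i<n. if i = j then x * b i else 0)"
      by (intro sum.cong) auto
    have "c (x * b j) i = (if i = j then x else 0)"
      by (rule ceq[OF _ _ i]) (use that j is_subfieldD(1)[OF K] delta in \<open>auto\<close>)
    thus "M x $$ (i, j) = (x \<cdot>\<^sub>m 1\<^sub>m n) $$ (i, j)" using i j by (simp add: M_def)
  qed (simp_all add: M_def)
  show thesis
  proof (rule that[of n "\<lambda>x. det (M x)"])
    show "n > 0"
    proof (rule ccontr)
      assume "\<not> n > 0"
      thus False using c[of 1] by simp
    qed
    show "det (M (x * y)) = det (M x) * det (M y)" for x y
      by (simp add: Mprod det_mult[OF Mdim Mdim])
    show "det (M x) = x ^ n" if "x \<in> K" for x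
      using Mscalar[OF that] by simp
    show "det (M 1) = 1" using Mscalar[of 1] is_subfieldD(2)[OF K] by simp
    show "det (M x) \<in> K" for x
      unfolding det_def'[OF Mdim]
    proof (intro is_subfield_sum[OF K] is_subfieldD(4)[OF K] is_subfield_prod[OF K])
      fix p assume p: "p \<in> {p. p permutes {0..<n}}"
      show "signof p \<in> K" by (auto simp: sign_def intro: is_subfieldD[OF K])
      show "M x $$ (i, p i) \<in> K" if "i \<in> {0..<n}" for i
        using that p permutes_in_image[of p "{0..<n}" i] by (auto simp: M_def intro!: cK)
    qed
  qed
qed

section \<open>Finite algebraic extensions, carried over from HOL-Algebra rings\<close>

abbreviation type_ring :: "'a::field ring" ("\<R>") where "\<R> \<equiv> ring_of_type_algebra"

lemma type_ring_simps [simp]: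
  "carrier \<R> = UNIV" "x \<otimes>\<^bsub>\<R>\<^esub> y = x * y" "x \<oplus>\<^bsub>\<R>\<^esub> y = x + y" "\<zero>\<^bsub>\<R>\<^esub> = 0" "\<one>\<^bsub>\<R>\<^esub> = 1"
  by (simp_all add: ring_of_type_algebra_def)

lemma type_ring_power [simp]: "x [^]\<^bsub>\<R>\<^esub> (n::nat) = x ^ n"
  by (induction n) (simp_all add: nat_pow_def ring_of_type_algebra_def)

lemma type_ring_a_inv [simp]: "\<ominus>\<^bsub>\<R>\<^esub> (x::'a::field) = - x"
proof -
  interpret field "\<R> :: 'a ring" by (rule field_from_type_algebra)
  show ?thesis using add.inv_equality[of "-x" x] by (simp add: a_inv_def)
qed

lemma type_ring_m_inv [simp]: "x \<noteq> 0 \<Longrightarrow> inv\<^bsub>\<R>\<^esub> (x::'a::field) = inverse x"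
proof -
  interpret field "\<R> :: 'a ring" by (rule field_from_type_algebra)
  assume "x \<noteq> 0"
  thus ?thesis using comm_inv_char[of x "inverse x"] by simp
qed

lemma subfield_type_ring_iff: "subfield K (\<R> :: 'a::field ring) \<longleftrightarrow> is_subfield K"
proof -
  interpret field "\<R> :: 'a ring" by (rule field_from_type_algebra)
  show ?thesis
  proof
    assume K: "is_subfield K"
    show "subfield K \<R>"
    proof (rule subfieldI')
      show "subring K \<R>" by (rule subringI) (auto intro: is_subfieldD[OF K])
    qed (auto intro: is_subfieldD[OF K])
  next
    assume K: "subfield K \<R>"
    note R = subringE[OF subfieldE(1)[OF K]]
    have "inverse x \<in> K" if "x \<in> K" for x
      using subfield_m_inv(1)[OF K, of x] that R(2) by (cases "x = 0") auto
    thus "is_subfield K" unfolding is_subfield_def using R by auto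
  qed
qed

text \<open>HOL-Algebra lists coefficients from the leading one downwards, \<open>Poly\<close> from
  the constant one upwards; hence \<open>rev\<close>.\<close>

lemma eval_type_ring: "ring.eval \<R> p x = poly (Poly (rev p)) (x::'a::field)"
proof -
  interpret field "\<R> :: 'a ring" by (rule field_from_type_algebra)
  show ?thesis
    by (induction p) (auto simp: Poly_append poly_monom mult.commute)
qed

lemma algebraic_type_ring_iff:
  assumes "is_subfield K"
  shows "(ring.algebraic \<R> over K) x \<longleftrightarrow> algebraic_over K (x::'a::field)"
proof -
  interpret field "\<R> :: 'a ring" by (rule field_from_type_algebra)
  have K: "subfield K \<R>" using assms subfield_type_ring_iff by blast
  show ?thesis
  proof
    assume "(algebraic over K) x"
    then obtain p where p: "p \<in> carrier (K[X]\<^bsub>\<R>\<^esub>)" "p \<noteq> []" "eval p x = \<zero>\<^bsub>\<R>\<^esub>"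
      using algebraicE[OF subfieldE(1)[OF K], of x] by auto
    have pK: "set p \<subseteq> K" "hd p \<noteq> 0"
      using p(1,2) by (auto simp: univ_poly_def polynomial_def)
    have "Polynomial.coeff (Poly (rev p)) i \<in> K" for i
      using pK(1) is_subfieldD(1)[OF assms] by (auto simp: nth_default_def rev_nth)
    moreover have "Poly (rev p) \<noteq> 0"
      using pK(2) p(2) by (metis Poly_eq_0 hd_in_set in_set_replicate set_rev)
    ultimately show "algebraic_over K x"
      unfolding algebraic_over_def using p(3) by (auto simp: eval_type_ring)
  next
    assume "algebraic_over K x"
    then obtain q where q: "q \<noteq> 0" "\<And>i. Polynomial.coeff q i \<in> K" "poly q x = 0"
      unfolding algebraic_over_def by blast
    show "(algebraic over K) x"
    proof (rule algebraicI)
      show "rev (coeffs q) \<noteq> []" using q(1) by simp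
      show "rev (coeffs q) \<in> carrier (K[X]\<^bsub>\<R>\<^esub>)"
        using q(1,2) unfolding univ_poly_def polynomial_def
        by (auto simp: coeffs_def hd_rev last_map)
      show "eval (rev (coeffs q)) x = \<zero>\<^bsub>\<R>\<^esub>"
        using q(3) by (simp add: eval_type_ring)
    qed
  qed
qed

lemma combine_type_ring:
  "ring.combine \<R> Ks Us = (\<Sum>i<min (length Ks) (length Us). Ks ! i * (Us ! i::'a::field))"
proof -
  interpret field "\<R> :: 'a ring" by (rule field_from_type_algebra)
  show ?thesis
    by (induction Ks Us rule: combine.induct)
      (simp_all add: sum.lessThan_Suc_shift del: sum.lessThan_Suc)
qed

lemma finite_dim_over_type_ring:
  assumes "is_subfield K" "ring.finite_dimension \<R> K UNIV"
  shows "finite_dim_over (K::'a::field set)"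
proof -
  interpret field "\<R> :: 'a ring" by (rule field_from_type_algebra)
  have K: "subfield K \<R>" using assms subfield_type_ring_iff by blast
  obtain n where "dimension n K UNIV" using assms(2) by blast
  then obtain Us where Us: "Span K Us = UNIV"
    using exists_base[OF K] by metis
  have "spans_over K ((!) Us) (length Us)"
    unfolding spans_over_def
  proof
    fix x
    have "x \<in> Span K Us" using Us by simp
    then obtain Ks where Ks: "length Ks = length Us" "set Ks \<subseteq> K" "x = combine Ks Us"
      using Span_eq_combine_set_length_version[OF K, of Us] by auto
    thus "\<exists>c. (\<forall>i<length Us. c i \<in> K) \<and> x = (\<Sum>i<length Us. c i * Us ! i)"
      by (intro exI[of _ "(!) Ks"]) (auto simp: combine_type_ring)
  qed
  thus ?thesis unfolding finite_dim_over_def by blast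
qed

text \<open>Adjoining the finitely many algebraic elements of \<open>S\<close> to \<open>K\<close>
  gives a finite algebraic subfield containing both, which is therefore everything.\<close>

lemma finite_dim_over_if_all_algebraic:
  assumes K: "is_subfield (K::'a::field set)" and S: "finite S" "gen_subfield (K \<union> S) = UNIV"
    and alg: "\<And>x. x \<in> S \<Longrightarrow> algebraic_over K x"
  shows "finite_dim_over K" "algebraic_over K y"
proof -
  interpret field "\<R> :: 'a ring" by (rule field_from_type_algebra)
  have K': "subfield K \<R>" using assms subfield_type_ring_iff by blast
  obtain xs where xs: "set xs = S" using finite_list[OF S(1)] by blast
  have xs': "set xs \<subseteq> carrier \<R>" by simp
  have alg': "(algebraic over K) x" if "x \<in> set xs" for x
    using algebraic_type_ring_iff[OF K] alg that xs by blast
  have "is_subfield (finite_extension K xs)"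
    using finite_extension_is_subfield[OF K' xs' alg'] subfield_type_ring_iff by blast
  moreover have "K \<union> S \<subseteq> finite_extension K xs"
    using finite_extension_incl[OF subfieldE(3)[OF K'] xs']
      finite_extension_mem[OF subfieldE(1)[OF K'] xs'] xs by blast
  ultimately have *: "finite_extension K xs = UNIV"
    using gen_subfield_least S(2) by (metis top.extremum_uniqueI)
  have "finite_dimension K (finite_extension K xs)"
    by (rule finite_extension_finite_dimension(1)[OF K' xs' alg'])
  thus "finite_dim_over K"
    unfolding * by (rule finite_dim_over_type_ring[OF K])
  show "algebraic_over K y"
    using finite_extesion_mem_imp_algebraic[OF K' xs' alg', of y] *
      algebraic_type_ring_iff[OF K] by blast
qed

text \<open>Induction on the number of generators outside the base. A generator transcendental over
  \<open>K\<close> is moved into the base. This ends over a base where all remaining generators are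
  algebraic; the last element moved is the \<open>s\<close> of the second alternative.\<close>

lemma finitely_generated_dichotomy:
  assumes "finite S" "is_subfield (K::'a::field set)" "gen_subfield (K \<union> S) = UNIV"
  shows "finite_dim_over K \<and> (\<forall>y. algebraic_over K y) \<or>
    (\<exists>(K'::'a set) s. is_subfield K' \<and> \<not> algebraic_over K' s \<and> finite_dim_over (gen_subfield (insert s K')))"
  using assms
proof (induction "card S" arbitrary: S K rule: less_induct)
  case (less S K)
  show ?case
  proof (cases "\<forall>x\<in>S. algebraic_over K x")
    case True
    thus ?thesis using finite_dim_over_if_all_algebraic[OF less.prems(2,1,3)] by blast
  next
    case False
    then obtain s where s: "s \<in> S" "\<not> algebraic_over K s" by blast
    let ?K = "gen_subfield (insert s K)"
    have "K \<union> S \<subseteq> ?K \<union> (S - {s})" using gen_subfield_incl[of "insert s K"] by blast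
    also have "\<dots> \<subseteq> gen_subfield (?K \<union> (S - {s}))" by (rule gen_subfield_incl)
    finally have "gen_subfield (?K \<union> (S - {s})) = UNIV"
      using gen_subfield_least[OF is_subfield_gen_subfield] less.prems(3) by (metis top.extremum_uniqueI)
    moreover have "card (S - {s}) < card S" using s(1) less.prems(1) by (metis card_Diff1_less)
    ultimately have "finite_dim_over ?K \<and> (\<forall>y. algebraic_over ?K y) \<or>
      (\<exists>(K'::'a set) s. is_subfield K' \<and> \<not> algebraic_over K' s \<and> finite_dim_over (gen_subfield (insert s K')))"
      using less.hyps[OF _ _ is_subfield_gen_subfield, of "S - {s}" "insert s K"] less.prems(1) by simp
    \<comment> \<open>If the first alternative holds over \<open>?K\<close>, then \<open>K\<close>
      and \<open>s\<close> witness the second one.\<close>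
    thus ?thesis using s(2) less.prems(2) by metis
  qed
qed

text \<open>The norm descent for an abstract \<open>\<tau>\<close>. The hypothesis
  \<open>no_root\<close> is what a valuation on \<open>K\<close> with value 1 at
  \<open>\<tau>\<close> provides: \<open>y ^ N = \<tau> ^ m\<close> up to sign would give
  \<open>N dvd m\<close>, impossible for \<open>0 < m < N\<close>.\<close>

lemma exists_non_power:
  fixes \<tau> :: "'a::field" and q :: nat
  assumes K: "is_subfield K" and fd: "finite_dim_over K" and \<tau>: "\<tau> \<in> K" and q: "q \<ge> 2"
    and no_root: "\<And>y m N. y \<in> K \<Longrightarrow> 0 < m \<Longrightarrow> m < N \<Longrightarrow> y ^ N \<noteq> \<tau> ^ m \<and> y ^ N \<noteq> - (\<tau> ^ m)"
  shows "\<exists>a::'a. \<forall>x. x ^ q \<noteq> a \<and> x ^ q \<noteq> - a"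
proof (rule ccontr)
  assume "\<not> ?thesis"
  hence root: "\<exists>x. x ^ q = a \<or> x ^ q = - a" for a :: 'a by blast
  \<comment> \<open>Perhaps only \<open>- x\<close> has a \<open>q\<close>-th root, but its sign
    comes out of the power \<open>q ^ j\<close>, so the tower continues up to sign.\<close>
  have tower: "\<exists>x. x ^ (q ^ j) = \<tau> \<or> x ^ (q ^ j) = - \<tau>" for j
  proof (induction j)
    case 0
    thus ?case by auto
  next
    case (Suc j)
    then obtain x where x: "x ^ (q ^ j) = \<tau> \<or> x ^ (q ^ j) = - \<tau>" by blast
    obtain z where z: "z ^ q = x \<or> z ^ q = - x" using root by blast
    have "z ^ (q ^ Suc j) = (z ^ q) ^ (q ^ j)" by (simp add: power_mult)
    moreover have "(- x) ^ (q ^ j) = x ^ (q ^ j) \<or> (- x) ^ (q ^ j) = - (x ^ (q ^ j))"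
      by (cases "even (q ^ j)") simp_all
    ultimately have "z ^ (q ^ Suc j) = x ^ (q ^ j) \<or> z ^ (q ^ Suc j) = - (x ^ (q ^ j))"
      using z by auto
    thus ?case using x by auto
  qed
  from finite_dim_norm[OF K fd] obtain Nm :: "'a \<Rightarrow> 'a" and n :: nat
    where n: "n > 0" "\<And>x. Nm x \<in> K" "\<And>x y. Nm (x * y) = Nm x * Nm y" "Nm 1 = 1"
      "\<And>x. x \<in> K \<Longrightarrow> Nm x = x ^ n" by metis
  have Nm_pow: "Nm (x ^ k) = Nm x ^ k" for x k
    by (induction k) (simp_all add: n(3,4))
  \<comment> \<open>Height \<open>n\<close>, the exponent of the norm on \<open>K\<close>, suffices:
    taking norms gives \<open>m = n\<close> and \<open>N = q ^ n\<close>, and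
    \<open>n < q ^ n\<close>.\<close>
  obtain x where x: "x ^ (q ^ n) = \<tau> \<or> x ^ (q ^ n) = - \<tau>" using tower by blast
  have "Nm x ^ (q ^ n) = Nm (x ^ (q ^ n))" by (simp add: Nm_pow)
  hence "Nm x ^ (q ^ n) = \<tau> ^ n \<or> Nm x ^ (q ^ n) = (- \<tau>) ^ n"
    using x n(5)[OF \<tau>] n(5)[OF is_subfieldD(5)[OF K \<tau>]] by auto
  moreover have "(- \<tau>) ^ n = \<tau> ^ n \<or> (- \<tau>) ^ n = - (\<tau> ^ n)"
    by (cases "even n") auto
  ultimately have "Nm x ^ (q ^ n) = \<tau> ^ n \<or> Nm x ^ (q ^ n) = - (\<tau> ^ n)" by metis
  moreover have "n < q ^ n" using q by (simp add: power_gt_expt)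
  ultimately show False using no_root[OF n(2) n(1)] by metis
qed

text \<open>The 2-adic valuations of \<open>a ^ N = 2 ^ m * b ^ N\<close> give
  \<open>N dvd m\<close>. The absolute value treats both signs at once.\<close>

lemma rational_power_ne_power_2:
  fixes y :: rat
  assumes "0 < m" "m < (N::nat)"
  shows "\<bar>y\<bar> ^ N \<noteq> 2 ^ m"
proof
  assume eq: "\<bar>y\<bar> ^ N = 2 ^ m"
  obtain a b where ab: "quotient_of \<bar>y\<bar> = (a, b)" by fastforce
  have b: "b > 0" using quotient_of_denom_pos[OF ab] .
  have y: "\<bar>y\<bar> = of_int a / of_int b" using quotient_of_div[OF ab] .
  have "(of_int (a ^ N) :: rat) = of_int (2 ^ m * b ^ N)"
    using eq b unfolding y by (simp add: power_divide field_simps)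
  hence eq': "a ^ N = 2 ^ m * b ^ N" by (simp only: of_int_eq_iff)
  have a: "a \<noteq> 0" using eq' b assms by (auto simp: power_0_left)
  have "multiplicity 2 (a ^ N) = N * multiplicity 2 a"
    by (rule prime_elem_multiplicity_power_distrib) (use a in auto)
  moreover have "multiplicity 2 (2 ^ m * b ^ N) = m + N * multiplicity 2 b"
    using b by (simp add: prime_elem_multiplicity_mult_distrib prime_elem_multiplicity_power_distrib)
  ultimately have "N * multiplicity 2 a = m + N * multiplicity 2 b" using eq' by simp
  hence "N dvd m" by (metis dvd_add_left_iff dvd_triv_left)
  thus False using assms by (simp add: nat_dvd_not_less)
qed

text \<open>The prime field lies in the image of the rationals, so the claim descends to
  \<open>rat\<close>.\<close>

lemma prime_field_power_ne:
  fixes y :: "'a::field_char_0"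
  assumes "y \<in> gen_subfield {}" "0 < m" "m < N"
  shows "y ^ N \<noteq> 2 ^ m \<and> y ^ N \<noteq> - (2 ^ m)"
proof -
  have "is_subfield (range (of_rat :: rat \<Rightarrow> 'a))"
    unfolding is_subfield_def
    by (auto simp flip: of_rat_add of_rat_mult of_rat_minus of_rat_inverse
        intro: range_eqI[of 0 _ 0] range_eqI[of 1 _ 1])
  then obtain r where r: "y = of_rat r"
    using gen_subfield_least[of _ "{}"] assms(1) by blast
  have "y ^ N = of_rat (r ^ N)" "(2::'a) ^ m = of_rat (2 ^ m)" "- ((2::'a) ^ m) = of_rat (- (2 ^ m))"
    by (simp_all add: r of_rat_power of_rat_minus)
  moreover have "r ^ N \<noteq> 2 ^ m" "r ^ N \<noteq> - (2 ^ m)"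
    using rational_power_ne_power_2[OF assms(2,3), of r] by (auto simp flip: power_abs)
  ultimately show ?thesis by simp
qed

section \<open>Polynomials over a subfield and simple transcendental extensions\<close>

definition polys_over :: "'a::field set \<Rightarrow> 'a poly set" where
  "polys_over K = {p. \<forall>i. coeff p i \<in> K}"

lemma polys_over_closed:
  assumes "is_subfield K"
  shows "p \<in> polys_over K \<Longrightarrow> q \<in> polys_over K \<Longrightarrow> p + q \<in> polys_over K"
    "p \<in> polys_over K \<Longrightarrow> - p \<in> polys_over K"
    "p \<in> polys_over K \<Longrightarrow> q \<in> polys_over K \<Longrightarrow> p * q \<in> polys_over K"
    "a \<in> K \<Longrightarrow> Polynomial.monom a m \<in> polys_over K"
    "p \<in> polys_over K \<Longrightarrow> p ^ m \<in> polys_over K"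
proof -
  show mult: "p \<in> polys_over K \<Longrightarrow> q \<in> polys_over K \<Longrightarrow> p * q \<in> polys_over K" for p q
    unfolding polys_over_def mem_Collect_eq coeff_mult
    by (blast intro: is_subfield_sum[OF assms] is_subfieldD(4)[OF assms])
  have one: "1 \<in> polys_over K"
    using is_subfieldD(1,2)[OF assms] by (simp add: polys_over_def coeff_1)
  show "p \<in> polys_over K \<Longrightarrow> p ^ m \<in> polys_over K"
    by (induction m) (auto intro: mult one)
  show "p \<in> polys_over K \<Longrightarrow> q \<in> polys_over K \<Longrightarrow> p + q \<in> polys_over K"
    "p \<in> polys_over K \<Longrightarrow> - p \<in> polys_over K"
    "a \<in> K \<Longrightarrow> Polynomial.monom a m \<in> polys_over K"
    using is_subfieldD(1,3,5)[OF assms] by (simp_all add: polys_over_def coeff_monom)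
qed

text \<open>The fractions \<open>poly A s / poly B s\<close> already form a subfield containing
  \<open>s\<close> and \<open>K\<close>.\<close>

lemma simple_subfield_fraction:
  assumes K: "is_subfield (K::'a::field set)" and y: "y \<in> gen_subfield (insert s K)"
  obtains A B where "A \<in> polys_over K" "B \<in> polys_over K" "poly B s \<noteq> 0" "y = poly A s / poly B s"
proof -
  define F where "F = {poly A s / poly B s |A B. A \<in> polys_over K \<and> B \<in> polys_over K \<and> poly B s \<noteq> 0}"
  note PC = polys_over_closed[OF K]
  have const: "[:a:] \<in> polys_over K" if "a \<in> K" for a
    using PC(4)[OF that, of 0] by (simp add: monom_0)
  have FI: "poly A s / poly B s \<in> F" if "A \<in> polys_over K" "B \<in> polys_over K" "poly B s \<noteq> 0" for A B
    unfolding F_def using that by blast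
  have KF: "a \<in> F" if "a \<in> K" for a
    using FI[OF const[OF that] const[OF is_subfieldD(2)[OF K]]] by simp
  have "is_subfield F"
    unfolding is_subfield_def
  proof (intro conjI ballI)
    show "0 \<in> F" "1 \<in> F" using KF is_subfieldD(1,2)[OF K] by auto
  next
    fix u v assume "u \<in> F" "v \<in> F"
    then obtain A B A' B' where *: "A \<in> polys_over K" "B \<in> polys_over K" "poly B s \<noteq> 0"
      "u = poly A s / poly B s" "A' \<in> polys_over K" "B' \<in> polys_over K" "poly B' s \<noteq> 0"
      "v = poly A' s / poly B' s"
      unfolding F_def by blast
    have "u + v = poly (A * B' + A' * B) s / poly (B * B') s" "u * v = poly (A * A') s / poly (B * B') s"
      unfolding *(4,8) using *(3,7) by (simp_all add: field_simps)
    thus "u + v \<in> F" "u * v \<in> F"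
      using FI[of "A * B' + A' * B" "B * B'"] FI[of "A * A'" "B * B'"] PC * by simp_all
  next
    fix u assume "u \<in> F"
    then obtain A B where *: "A \<in> polys_over K" "B \<in> polys_over K" "poly B s \<noteq> 0" "u = poly A s / poly B s"
      unfolding F_def by blast
    show "- u \<in> F" using FI[of "- A" B] PC * by simp
    show "inverse u \<in> F"
    proof (cases "poly A s = 0")
      case True
      thus ?thesis using * KF is_subfieldD(1)[OF K] by simp
    next
      case False
      thus ?thesis using FI[of B A] * by simp
    qed
  qed
  moreover have "s \<in> F"
    using FI[OF PC(4)[OF is_subfieldD(2)[OF K], of 1] const[OF is_subfieldD(2)[OF K]]]
    by (simp add: poly_monom)
  ultimately have "y \<in> F" using gen_subfield_least[of F "insert s K"] y KF by blast
  thus thesis using that unfolding F_def by blast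
qed

text \<open>With denominators cleared the equation compares polynomial values at \<open>s\<close>,
  and transcendence lifts it to the polynomials: \<open>A ^ N = \<epsilon> X^m B ^ N\<close>.
  Degrees then give \<open>N dvd m\<close>.\<close>

lemma transcendental_power_ne:
  fixes y :: "'a::field_char_0"
  assumes K: "is_subfield K" and s: "\<not> algebraic_over K s"
    and y: "y \<in> gen_subfield (insert s K)" and mN: "0 < m" "m < N"
    and \<epsilon>: "\<epsilon> = 1 \<or> \<epsilon> = - 1"
  shows "y ^ N \<noteq> \<epsilon> * s ^ m"
proof
  assume eq: "y ^ N = \<epsilon> * s ^ m"
  obtain A B where AB: "A \<in> polys_over K" "B \<in> polys_over K" "poly B s \<noteq> 0" "y = poly A s / poly B s"
    using simple_subfield_fraction[OF K y] .
  have \<epsilon>K: "- \<epsilon> \<in> K" and \<epsilon>0: "\<epsilon> \<noteq> 0" using \<epsilon> is_subfieldD[OF K] by auto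
  define D where "D = A ^ N + Polynomial.monom (- \<epsilon>) m * B ^ N"
  have "D \<in> polys_over K"
    unfolding D_def by (intro polys_over_closed[OF K] AB \<epsilon>K)
  moreover have "poly D s = 0"
    using eq AB(3) by (simp add: D_def AB(4) poly_monom power_divide field_simps)
  ultimately have "D = 0" using s unfolding algebraic_over_def polys_over_def by blast
  hence eq': "A ^ N = Polynomial.monom \<epsilon> m * B ^ N"
    by (simp add: D_def minus_monom[symmetric])
  have B: "B \<noteq> 0" using AB(3) by auto
  have "degree (A ^ N) = m + N * degree B"
    unfolding eq' using B \<epsilon>0 by (simp add: degree_mult_eq degree_monom_eq degree_power_eq)
  moreover have "degree (A ^ N) = N * degree A"
    by (cases "A = 0") (use mN in \<open>auto simp: degree_power_eq power_0_left\<close>)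
  ultimately have "N dvd m" by (metis dvd_add_left_iff dvd_triv_left)
  thus False using mN by (simp add: nat_dvd_not_less)
qed

lemma exists_non_power_up_to_sign:
  assumes fg: "finitely_generated_field TYPE('k::field_char_0)
           \<or> finite_transcendental_extension TYPE('k)" and q: "q \<ge> 2"
  shows "\<exists>a::'k. \<forall>x. x ^ q \<noteq> a \<and> x ^ q \<noteq> - a"
proof -
  have case_transcendental: ?thesis if "is_subfield K" "\<not> algebraic_over K s"
    "finite_dim_over (gen_subfield (insert s K))" for K :: "'k set" and s
  proof (rule exists_non_power[OF is_subfield_gen_subfield that(3) _ q])
    show "s \<in> gen_subfield (insert s K)" using gen_subfield_incl[of "insert s K"] by blast
    show "y ^ N \<noteq> s ^ m \<and> y ^ N \<noteq> - (s ^ m)"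
      if "y \<in> gen_subfield (insert s K)" "0 < m" "m < N" for y m N
      using transcendental_power_ne[OF \<open>is_subfield K\<close> \<open>\<not> algebraic_over K s\<close> that, of 1]
        transcendental_power_ne[OF \<open>is_subfield K\<close> \<open>\<not> algebraic_over K s\<close> that, of "-1"] by auto
  qed
  from fg show ?thesis
  proof
    assume "finitely_generated_field TYPE('k)"
    then obtain S :: "'k set" where S: "finite S" "gen_subfield S = UNIV"
      unfolding finitely_generated_field_def by blast
    have "gen_subfield (gen_subfield {} \<union> S) = UNIV"
      using gen_subfield_least[OF is_subfield_gen_subfield, of S "gen_subfield {} \<union> S"]
        gen_subfield_incl[of "gen_subfield {} \<union> S"] S(2) by blast
    from finitely_generated_dichotomy[OF S(1) is_subfield_gen_subfield this]
    show ?thesis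
    proof
      assume fd: "finite_dim_over (gen_subfield {} :: 'k set) \<and> (\<forall>y. algebraic_over (gen_subfield {}) y)"
      have "(2::'k) \<in> gen_subfield {}"
        using is_subfieldD(2,3)[OF is_subfield_gen_subfield] by (metis one_add_one)
      with fd show ?thesis
        by (intro exists_non_power[OF is_subfield_gen_subfield _ _ q prime_field_power_ne]) auto
    qed (use case_transcendental in blast)
  next
    assume "finite_transcendental_extension TYPE('k)"
    then obtain K S and t :: 'k where "is_subfield K" "finite S" "gen_subfield (K \<union> S) = UNIV"
      "\<not> algebraic_over K t"
      unfolding finite_transcendental_extension_def by blast
    \<comment> \<open>The transcendental \<open>t\<close> excludes the algebraic alternative of the
      dichotomy.\<close>
    thus ?thesis using finitely_generated_dichotomy case_transcendental by blast
  qed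
qed

section \<open>Lines in coordinates\<close>

lemma sum_cubic_monos:
  "(\<Sum>e\<in>cubic_monos. f e) = f (0,0,0) + f (0,0,1) + f (0,0,2) + f (0,0,3) + f (0,1,1) + f (0,1,2)
    + f (0,1,3) + f (0,2,2) + f (0,2,3) + f (0,3,3) + f (1,1,1) + f (1,1,2) + f (1,1,3) + f (1,2,2)
    + f (1,2,3) + f (1,3,3) + f (2,2,2) + f (2,2,3) + f (2,3,3) + (f (3,3,3) :: 'a::comm_monoid_add)"
proof -
  have "(\<Sum>e\<in>cubic_monos. f e) = (\<Sum>(l, j, i)\<in>(SIGMA l:{..<4}. SIGMA j:{..l}. {..j}). f (i, j, l))"
    unfolding cubic_monos_def
    by (rule sum.reindex_bij_witness[of _ "\<lambda>(l, j, i). (i, j, l)" "\<lambda>(i, j, l). (l, j, i)"]) auto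
  also have "\<dots> = (\<Sum>l<4. \<Sum>j\<le>l. \<Sum>i\<le>j. f (i, j, l))"
    by (simp add: sum.Sigma)
  finally show ?thesis by (simp add: eval_nat_numeral add_ac)
qed

text \<open>The derivative of the form at \<open>u\<close> in direction \<open>v\<close>, that is,
  the coefficient of \<open>s ^ 2 * t\<close> at \<open>s u + t v\<close>.\<close>

definition cubic_polar ::
  "('a \<Rightarrow> 'b::comm_ring_1) \<Rightarrow> (nat \<times> nat \<times> nat \<Rightarrow> 'a) \<Rightarrow> (nat \<Rightarrow> 'b) \<Rightarrow> (nat \<Rightarrow> 'b) \<Rightarrow> 'b" where
  "cubic_polar phi c u v =
     (\<Sum>(i, j, l)\<in>cubic_monos. phi (c (i, j, l)) * (u i * u j * v l + u i * v j * u l + v i * u j * u l))"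

lemma cubic_eval_pencil:
  "cubic_eval phi c (\<lambda>i. s * u i + t * v i) =
     s ^ 3 * cubic_eval phi c u + s ^ 2 * t * cubic_polar phi c u v
     + s * t ^ 2 * cubic_polar phi c v u + t ^ 3 * cubic_eval phi c v"
  unfolding cubic_eval_def cubic_polar_def sum_distrib_left sum.distrib[symmetric]
  by (rule sum.cong) (auto simp: algebra_simps power2_eq_square power3_eq_cube)

lemma cubic_eval_to_ac: "cubic_eval to_ac c (\<lambda>i. to_ac (u i)) = to_ac (cubic_eval id c u)"
  unfolding cubic_eval_def to_ac_sum by (rule sum.cong) auto

lemma cubic_polar_to_ac:
  "cubic_polar to_ac c (\<lambda>i. to_ac (u i)) (\<lambda>i. to_ac (v i)) = to_ac (cubic_polar id c u v)"
  unfolding cubic_polar_def to_ac_sum by (rule sum.cong) auto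

definition is_line :: "(nat \<Rightarrow> 'a::field) set \<Rightarrow> bool" where
  "is_line L \<longleftrightarrow> (\<exists>p q. vec4 p \<and> vec4 q \<and> lin_indep2 p q \<and> L = span2 p q)"

text \<open>The parameters \<open>(1, 0)\<close>, \<open>(0, 1)\<close>, \<open>(1, 1)\<close>,
  \<open>(1, -1)\<close> determine the coefficients, because 2 is invertible.\<close>

lemma binary_cubic_zero_iff:
  fixes a b c d :: "'a::field_char_0"
  shows "(\<forall>s t. s ^ 3 * a + s ^ 2 * t * b + s * t ^ 2 * c + t ^ 3 * d = 0) \<longleftrightarrow>
    a = 0 \<and> b = 0 \<and> c = 0 \<and> d = 0"
proof
  assume k: "\<forall>s t. s ^ 3 * a + s ^ 2 * t * b + s * t ^ 2 * c + t ^ 3 * d = 0"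
  have a: "a = 0" and d: "d = 0" using k[rule_format, of 1 0] k[rule_format, of 0 1] by simp_all
  have "b + c = 0" "- b + c = 0" using k[rule_format, of 1 1] k[rule_format, of 1 "-1"] a d by simp_all
  hence "2 * c = 0" "b = c" by (simp_all add: algebra_simps)
  thus "a = 0 \<and> b = 0 \<and> c = 0 \<and> d = 0" using a d by simp
qed simp

lemma line_on_surface_iff:
  fixes c :: "nat \<times> nat \<times> nat \<Rightarrow> 'a::field_char_0"
  shows "line_on_surface c L \<longleftrightarrow> is_line L \<and> (\<forall>x\<in>L. cubic_eval id c x = 0)"
proof -
  have "(\<forall>s t :: 'a alg_closure. cubic_eval to_ac c (\<lambda>i. s * to_ac (p i) + t * to_ac (q i)) = 0)
    \<longleftrightarrow> (\<forall>x\<in>span2 p q. cubic_eval id c x = 0)" (is "?ac \<longleftrightarrow> ?k") for p q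
  proof
    assume ac: ?ac
    show ?k
    proof
      fix x assume "x \<in> span2 p q"
      then obtain s t where x: "x = (\<lambda>i. s * p i + t * q i)" unfolding span2_def by blast
      have "to_ac (cubic_eval id c x) = 0"
        using ac[rule_format, of "to_ac s" "to_ac t"] unfolding cubic_eval_to_ac[symmetric] x by simp
      thus "cubic_eval id c x = 0" by simp
    qed
  next
    assume k: ?k
    have *: "s ^ 3 * cubic_eval id c p + s ^ 2 * t * cubic_polar id c p q
     + s * t ^ 2 * cubic_polar id c q p + t ^ 3 * cubic_eval id c q = 0" for s t
    proof -
      have "(\<lambda>i. s * p i + t * q i) \<in> span2 p q" unfolding span2_def by blast
      thus ?thesis using k cubic_eval_pencil[of id c s p t q] by metis
    qed
    from * have "cubic_eval id c p = 0 \<and> cubic_polar id c p q = 0 \<and>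
        cubic_polar id c q p = 0 \<and> cubic_eval id c q = 0"
      unfolding binary_cubic_zero_iff[symmetric] by blast
    thus ?ac
      by (simp add: cubic_eval_pencil cubic_eval_to_ac cubic_polar_to_ac)
  qed
  thus ?thesis unfolding line_on_surface_def is_line_def by blast
qed

section \<open>Lines in the coordinates x, y, z, w\<close>

definition v4 :: "'a::zero \<Rightarrow> 'a \<Rightarrow> 'a \<Rightarrow> 'a \<Rightarrow> nat \<Rightarrow> 'a" where
  "v4 x y z w = (\<lambda>i. if i = 0 then x else if i = 1 then y else if i = 2 then z else if i = 3 then w else 0)"

lemma v4_nth [simp]:
  "v4 x y z w 0 = x" "v4 x y z w 1 = y" "v4 x y z w (Suc 0) = y" "v4 x y z w 2 = z" "v4 x y z w 3 = w"
  by (simp_all add: v4_def)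

lemma vec4_v4 [simp]: "vec4 (v4 x y z w)"
  by (simp add: vec4_def v4_def)

lemma vec4_eq_v4: "vec4 u \<Longrightarrow> u = v4 (u 0) (u 1) (u 2) (u 3)"
  unfolding vec4_def v4_def
  by (rule ext) auto

lemma v4_inject [simp]:
  "v4 x y z w = v4 x' y' z' w' \<longleftrightarrow> x = x' \<and> y = y' \<and> z = z' \<and> w = w'"
  by (metis v4_nth)

lemma pencil_v4:
  "(\<lambda>i. s * v4 x y z w i + t * v4 x' y' z' w' i) =
    v4 (s * x + t * x') (s * y + t * y') (s * z + t * z') (s * w + t * (w' :: 'a::field))"
  by (rule ext) (simp add: v4_def)

lemma span2_v4:
  "span2 (v4 x y z w) (v4 x' y' z' w') =
    {v4 (s * x + t * x') (s * y + t * y') (s * z + t * z') (s * w + t * (w' :: 'a::field)) |s t. True}"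
  unfolding span2_def pencil_v4 by auto

lemma lin_indep2_v4:
  "lin_indep2 (v4 x y z w) (v4 x' y' z' w') \<longleftrightarrow>
    (\<forall>s t. s * x + t * x' = 0 \<and> s * y + t * y' = 0 \<and> s * z + t * z' = 0 \<and> s * w + t * w' = (0 :: 'a::field)
      \<longrightarrow> s = 0 \<and> t = 0)"
proof -
  have "(\<forall>i. s * v4 x y z w i + t * v4 x' y' z' w' i = 0) \<longleftrightarrow>
    (\<lambda>i. s * v4 x y z w i + t * v4 x' y' z' w' i) = v4 0 0 0 0" for s t
  proof -
    have "v4 0 0 0 0 = (\<lambda>_. 0 :: 'a)" by (rule ext) (simp add: v4_def)
    thus ?thesis by (simp only: fun_eq_iff)
  qed
  thus ?thesis unfolding lin_indep2_def pencil_v4 v4_inject by simp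
qed

lemma span2_commute: "span2 (p :: nat \<Rightarrow> 'a::field) q = span2 q p"
proof -
  have "span2 p q \<subseteq> span2 q p" for p q :: "nat \<Rightarrow> 'a::field"
  proof
    fix x assume "x \<in> span2 p q"
    then obtain s t where "x = (\<lambda>i. s * p i + t * q i)" unfolding span2_def by blast
    hence "x = (\<lambda>i. t * q i + s * p i)" by (simp add: add.commute)
    thus "x \<in> span2 q p" unfolding span2_def by blast
  qed
  thus ?thesis by blast
qed

lemma span2_change_basis:
  assumes "a * d - b * c \<noteq> (0::'a::field)"
  shows "span2 (\<lambda>i. a * p i + b * q i) (\<lambda>i. c * p i + d * q i) = span2 p q"
proof (intro equalityI subsetI)
  fix x assume "x \<in> span2 (\<lambda>i. a * p i + b * q i) (\<lambda>i. c * p i + d * q i)"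
  then obtain s t where "x = (\<lambda>i. s * (a * p i + b * q i) + t * (c * p i + d * q i))"
    unfolding span2_def by blast
  hence "x = (\<lambda>i. (s * a + t * c) * p i + (s * b + t * d) * q i)"
    by (simp add: algebra_simps)
  thus "x \<in> span2 p q" unfolding span2_def by blast
next
  fix x assume "x \<in> span2 p q"
  then obtain s t where x: "x = (\<lambda>i. s * p i + t * q i)" unfolding span2_def by blast
  define e where "e = a * d - b * c"
  \<comment> \<open>Cramer's rule.\<close>
  define s' where "s' = (s * d - t * c) / e"
  define t' where "t' = (t * a - s * b) / e"
  have e: "e \<noteq> 0" using assms e_def by simp
  have "s' * a + t' * c = s * (a * d - b * c) / e" "s' * b + t' * d = t * (a * d - b * c) / e"
    using e by (simp_all add: s'_def t'_def field_simps)
  hence "s' * a + t' * c = s" "s' * b + t' * d = t" using e by (simp_all flip: e_def)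
  moreover have "s' * (a * p i + b * q i) + t' * (c * p i + d * q i)
    = (s' * a + t' * c) * p i + (s' * b + t' * d) * q i" for i
    by (simp add: algebra_simps)
  ultimately have "x = (\<lambda>i. s' * (a * p i + b * q i) + t' * (c * p i + d * q i))"
    by (simp add: x)
  thus "x \<in> span2 (\<lambda>i. a * p i + b * q i) (\<lambda>i. c * p i + d * q i)" unfolding span2_def by blast
qed

definition edge_line :: "(nat \<Rightarrow> 'a::field) set" where
  "edge_line = span2 (v4 1 0 0 0) (v4 0 1 0 0)"

text \<open>The line \<open>x = \<alpha> z + \<beta> w\<close>,
  \<open>y = \<gamma> z + \<delta> w\<close>. These are the lines disjoint from
  \<open>edge_line\<close>.\<close>

definition graph_line :: "'a::field \<Rightarrow> 'a \<Rightarrow> 'a \<Rightarrow> 'a \<Rightarrow> (nat \<Rightarrow> 'a) set" where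
  "graph_line \<alpha> \<beta> \<gamma> \<delta> = span2 (v4 \<alpha> \<gamma> 1 0) (v4 \<beta> \<delta> 0 1)"

text \<open>The cases are the positions of a line relative to the edge \<open>z = w = 0\<close>: equal to it, meeting it in a
  point, disjoint from it.\<close>

lemma is_line_cases:
  assumes "is_line (L :: (nat \<Rightarrow> 'a::field) set)"
  obtains (edge) "L = edge_line"
  | (meets) a b x y z w where "a \<noteq> 0 \<or> b \<noteq> 0" "z \<noteq> 0 \<or> w \<noteq> 0"
      "L = span2 (v4 a b 0 0) (v4 x y z w)"
  | (graph) \<alpha> \<beta> \<gamma> \<delta> where "L = graph_line \<alpha> \<beta> \<gamma> \<delta>"
proof -
  obtain p q where pq: "vec4 p" "vec4 q" "lin_indep2 p q" "L = span2 p q"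
    using assms unfolding is_line_def by blast
  obtain p0 p1 p2 p3 where p: "p = v4 p0 p1 p2 p3" using vec4_eq_v4[OF pq(1)] by blast
  obtain q0 q1 q2 q3 where q: "q = v4 q0 q1 q2 q3" using vec4_eq_v4[OF pq(2)] by blast
  have indep: "s = 0 \<and> t = 0" if "s * p0 + t * q0 = 0" "s * p1 + t * q1 = 0"
    "s * p2 + t * q2 = 0" "s * p3 + t * q3 = 0" for s t
    using pq(3) that unfolding p q lin_indep2_v4 by blast
  \<comment> \<open>If the \<open>(z, w)\<close>-parts of two spanning vectors \<open>u\<close>,
    \<open>r\<close> are proportional with factor \<open>m\<close>, then \<open>u - m r\<close> is a
    point of the edge.\<close>
  have meets': thesis if "r2 \<noteq> 0 \<or> r3 \<noteq> 0" "u2 = m * r2" "u3 = m * r3"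
    "L = span2 (v4 u0 u1 u2 u3) (v4 r0 r1 r2 r3)" "u0 - m * r0 \<noteq> 0 \<or> u1 - m * r1 \<noteq> 0"
    for r0 r1 r2 r3 u0 u1 u2 u3 m
  proof (rule meets[OF that(5,1)])
    have "(\<lambda>i. 1 * v4 u0 u1 u2 u3 i + - m * v4 r0 r1 r2 r3 i) = v4 (u0 - m * r0) (u1 - m * r1) 0 0"
      "(\<lambda>i. 0 * v4 u0 u1 u2 u3 i + 1 * v4 r0 r1 r2 r3 i) = v4 r0 r1 r2 r3"
      unfolding pencil_v4 by (simp_all add: that(2,3))
    moreover have "span2 (\<lambda>i. 1 * v4 u0 u1 u2 u3 i + - m * v4 r0 r1 r2 r3 i)
      (\<lambda>i. 0 * v4 u0 u1 u2 u3 i + 1 * v4 r0 r1 r2 r3 i) = L"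
      unfolding that(4) by (rule span2_change_basis) simp
    ultimately show "L = span2 (v4 (u0 - m * r0) (u1 - m * r1) 0 0) (v4 r0 r1 r2 r3)" by simp
  qed
  show thesis
  \<comment> \<open>The determinant of the \<open>(z, w)\<close>-parts. If it is nonzero, the
    inverse matrix turns these parts into \<open>(1, 0)\<close> and \<open>(0, 1)\<close>; otherwise
    they are proportional.\<close>
  proof (cases "p2 * q3 - p3 * q2 = 0")
    case False
    define e where "e = p2 * q3 - p3 * q2"
    have e: "e \<noteq> 0" using False e_def by simp
    have det: "(q3 / e) * (p2 / e) - (- p3 / e) * (- q2 / e) \<noteq> 0"
    proof -
      have "(q3 / e) * (p2 / e) - (- p3 / e) * (- q2 / e) = (p2 * q3 - p3 * q2) / (e * e)"
        by (simp add: diff_divide_distrib mult.commute)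
      thus ?thesis using e by (simp flip: e_def)
    qed
    have "L = span2 (\<lambda>i. q3 / e * p i + - p3 / e * q i) (\<lambda>i. - q2 / e * p i + p2 / e * q i)"
      using span2_change_basis[OF det, of p q] pq(4) by simp
    also have "(\<lambda>i. q3 / e * p i + - p3 / e * q i) =
      v4 (q3 / e * p0 + - p3 / e * q0) (q3 / e * p1 + - p3 / e * q1) 1 0"
      using e unfolding p q pencil_v4 by (simp add: field_simps) (simp add: e_def algebra_simps)
    also have "(\<lambda>i. - q2 / e * p i + p2 / e * q i) =
      v4 (- q2 / e * p0 + p2 / e * q0) (- q2 / e * p1 + p2 / e * q1) 0 1"
      using e unfolding p q pencil_v4 by (simp add: field_simps) (simp add: e_def algebra_simps)
    finally show thesis using graph unfolding graph_line_def by blast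
  next
    case det: True
    consider "p2 = 0" "p3 = 0" "q2 = 0" "q3 = 0" | "q2 \<noteq> 0" | "q3 \<noteq> 0" | "p2 \<noteq> 0 \<or> p3 \<noteq> 0" "q2 = 0" "q3 = 0"
      by blast
    thus thesis
    proof cases
      case 1
      have "p0 * q1 - p1 * q0 \<noteq> 0"
      proof
        assume d: "p0 * q1 - p1 * q0 = 0"
        have "q1 = 0 \<and> - p1 = 0" "q0 = 0 \<and> - p0 = 0"
          using indep[of q1 "- p1"] indep[of q0 "- p0"] d 1 by (simp_all add: algebra_simps)
        thus False using indep[of 1 1] 1 by simp
      qed
      from span2_change_basis[OF this, of "v4 1 0 0 0" "v4 0 1 0 0"] show thesis
        by (intro edge) (simp add: pq(4) p q 1 edge_line_def pencil_v4)
    next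
      case 2
      define m where "m = p2 / q2"
      have m: "p2 = m * q2" "p3 = m * q3" using 2 det by (simp_all add: m_def field_simps)
      have "p0 - m * q0 \<noteq> 0 \<or> p1 - m * q1 \<noteq> 0" using indep[of 1 "- m"] m by auto
      with 2 m pq(4) show thesis unfolding p q by (intro meets'[of q2 q3 p2 m p3 p0 p1 q0 q1]) auto
    next
      case 3
      define m where "m = p3 / q3"
      have m: "p2 = m * q2" "p3 = m * q3" using 3 det by (simp_all add: m_def field_simps)
      have "p0 - m * q0 \<noteq> 0 \<or> p1 - m * q1 \<noteq> 0" using indep[of 1 "- m"] m by auto
      with 3 m pq(4) show thesis unfolding p q by (intro meets'[of q2 q3 p2 m p3 p0 p1 q0 q1]) auto
    next
      case 4
      show thesis
        by (rule meets'[of p2 p3 q2 0 q3 q0 q1 p0 p1])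
          (use 4 indep[of 0 1] pq(4) span2_commute in \<open>auto simp: p q\<close>)
    qed
  qed
qed

lemma is_line_span2_v4:
  assumes "lin_indep2 (v4 x y z w) (v4 x' y' z' w')"
  shows "is_line (span2 (v4 x y z w) (v4 x' y' z' w'))"
  unfolding is_line_def using vec4_v4 assms by blast

lemma is_line_edge_line: "is_line edge_line"
  unfolding edge_line_def by (rule is_line_span2_v4) (simp add: lin_indep2_v4)

lemma is_line_meeting_edge:
  assumes "a \<noteq> 0 \<or> b \<noteq> 0" "z \<noteq> 0 \<or> w \<noteq> 0"
  shows "is_line (span2 (v4 a b 0 0) (v4 x y z w))"
  by (rule is_line_span2_v4) (use assms in \<open>auto simp: lin_indep2_v4\<close>)

lemma is_line_graph_line: "is_line (graph_line \<alpha> \<beta> \<gamma> \<delta>)"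
  unfolding graph_line_def by (rule is_line_span2_v4) (simp add: lin_indep2_v4)

lemma v4_mem_graph_line:
  "v4 x y z w \<in> graph_line \<alpha> \<beta> \<gamma> \<delta> \<longleftrightarrow> x = z * \<alpha> + w * \<beta> \<and> y = z * \<gamma> + w * \<delta>"
  unfolding graph_line_def span2_v4 by auto

lemma v4_mem_edge_line: "v4 x y z w \<in> edge_line \<longleftrightarrow> z = 0 \<and> w = 0"
  unfolding edge_line_def span2_v4 by auto

lemma graph_line_inject:
  "graph_line \<alpha> \<beta> \<gamma> \<delta> = graph_line \<alpha>' \<beta>' \<gamma>' \<delta>' \<longleftrightarrow> \<alpha> = \<alpha>' \<and> \<beta> = \<beta>' \<and> \<gamma> = \<gamma>' \<and> \<delta> = \<delta>'"
proof
  assume eq: "graph_line \<alpha> \<beta> \<gamma> \<delta> = graph_line \<alpha>' \<beta>' \<gamma>' \<delta>'"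
  have "v4 \<alpha> \<gamma> 1 0 \<in> graph_line \<alpha>' \<beta>' \<gamma>' \<delta>'" "v4 \<beta> \<delta> 0 1 \<in> graph_line \<alpha>' \<beta>' \<gamma>' \<delta>'"
    unfolding eq[symmetric] by (simp_all add: v4_mem_graph_line)
  thus "\<alpha> = \<alpha>' \<and> \<beta> = \<beta>' \<and> \<gamma> = \<gamma>' \<and> \<delta> = \<delta>'" by (simp add: v4_mem_graph_line)
qed simp

text \<open>The line through the point \<open>(a : 1 : 0 : 0)\<close> of the edge and its own point
  with \<open>y = 0\<close>, \<open>w = 1\<close>. This normalisation makes the parameters
  unique.\<close>

definition meeting_line :: "'a::field \<Rightarrow> 'a \<Rightarrow> 'a \<Rightarrow> (nat \<Rightarrow> 'a) set" where
  "meeting_line a x z = span2 (v4 a 1 0 0) (v4 x 0 z 1)"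

lemma meeting_line_eq:
  assumes "b \<noteq> 0" "w \<noteq> 0"
  shows "span2 (v4 a b 0 0) (v4 x y z w) = meeting_line (a / b) (x / w - y / w * (a / b)) (z / w)"
proof -
  have "span2 (v4 a b 0 0) (v4 x y z w) =
    span2 (\<lambda>i. 1 / b * v4 a b 0 0 i + 0 * v4 x y z w i)
      (\<lambda>i. - (y / (b * w)) * v4 a b 0 0 i + 1 / w * v4 x y z w i)"
    by (rule span2_change_basis[symmetric]) (use assms in simp)
  thus ?thesis
    unfolding pencil_v4 meeting_line_def using assms by (simp add: algebra_simps)
qed

lemma is_line_meeting_line: "is_line (meeting_line a x z)"
  unfolding meeting_line_def by (rule is_line_meeting_edge) auto

lemma v4_mem_meeting_line:
  "v4 x' y' z' w' \<in> meeting_line a x z \<longleftrightarrow> x' = y' * a + w' * x \<and> z' = w' * z"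
  unfolding meeting_line_def span2_v4 by auto

lemma meeting_line_inject:
  "meeting_line a x z = meeting_line a' x' z' \<longleftrightarrow> a = a' \<and> x = x' \<and> z = z'"
proof
  assume eq: "meeting_line a x z = meeting_line a' x' z'"
  have "v4 a 1 0 0 \<in> meeting_line a' x' z'" "v4 x 0 z 1 \<in> meeting_line a' x' z'"
    unfolding eq[symmetric] by (simp_all add: v4_mem_meeting_line)
  thus "a = a' \<and> x = x' \<and> z = z'" by (simp add: v4_mem_meeting_line)
qed simp

lemma edge_line_neq: "edge_line \<noteq> meeting_line a x z" "edge_line \<noteq> graph_line \<alpha> \<beta> \<gamma> \<delta>"
proof -
  have "v4 1 0 0 0 \<in> edge_line" "v4 1 0 0 0 \<notin> meeting_line a x z"
    "v4 1 0 0 0 \<notin> graph_line \<alpha> \<beta> \<gamma> \<delta>"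
    by (simp_all add: v4_mem_edge_line v4_mem_meeting_line v4_mem_graph_line)
  thus "edge_line \<noteq> meeting_line a x z" "edge_line \<noteq> graph_line \<alpha> \<beta> \<gamma> \<delta>" by blast+
qed

lemma meeting_line_neq_graph_line: "meeting_line a x z \<noteq> graph_line \<alpha> \<beta> \<gamma> \<delta>"
proof -
  have "v4 a 1 0 0 \<in> meeting_line a x z" "v4 a 1 0 0 \<notin> graph_line \<alpha> \<beta> \<gamma> \<delta>"
    by (simp_all add: v4_mem_meeting_line v4_mem_graph_line)
  thus ?thesis by blast
qed

lemma line_on_surface_v4:
  fixes c :: "nat \<times> nat \<times> nat \<Rightarrow> 'a::field_char_0"
  shows "line_on_surface c (span2 (v4 x y z w) (v4 x' y' z' w')) \<longleftrightarrow>
    is_line (span2 (v4 x y z w) (v4 x' y' z' w')) \<and> (\<forall>s t. cubic_eval id c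
      (v4 (s * x + t * x') (s * y + t * y') (s * z + t * z') (s * w + t * w')) = 0)"
  unfolding line_on_surface_iff span2_v4 by blast

section \<open>The cubic surface of a quintic\<close>

text \<open>The form \<open>z y^2 - w x^2 + x C + y D\<close>, with \<open>x, y, z, w\<close>
  numbered 0 to 3. The odd part of the quintic gives \<open>C = z^2 + p3 z w + p1 w^2\<close>, the
  even part gives \<open>D = p4 z^2 + p2 z w + p0 w^2\<close>.\<close>

definition quintic_surface :: "'a::field \<Rightarrow> 'a \<Rightarrow> 'a \<Rightarrow> 'a \<Rightarrow> 'a \<Rightarrow> nat \<times> nat \<times> nat \<Rightarrow> 'a" where
  "quintic_surface p0 p1 p2 p3 p4 = (\<lambda>_. 0)
    ((1,1,2) := 1, (0,0,3) := -1, (0,2,2) := 1, (0,2,3) := p3, (0,3,3) := p1,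
     (1,2,2) := p4, (1,2,3) := p2, (1,3,3) := p0)"

lemma cubic_eval_quintic_surface:
  assumes "phi 0 = 0" "phi 1 = 1" "phi (-1) = -1"
  shows "cubic_eval phi (quintic_surface p0 p1 p2 p3 p4) x =
    x 2 * x 1 ^ 2 - x 3 * x 0 ^ 2 + x 0 * (x 2 ^ 2 + phi p3 * x 2 * x 3 + phi p1 * x 3 ^ 2)
    + x 1 * (phi p4 * x 2 ^ 2 + phi p2 * x 2 * x 3 + phi p0 * x 3 ^ 2)"
  unfolding cubic_eval_def sum_cubic_monos quintic_surface_def
  by (simp add: assms power2_eq_square algebra_simps)

lemma cubic_partial_quintic_surface:
  assumes "phi 0 = 0" "phi 1 = 1" "phi (-1) = -1"
  shows "cubic_partial phi (quintic_surface p0 p1 p2 p3 p4) 0 x =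
      - 2 * x 3 * x 0 + (x 2 ^ 2 + phi p3 * x 2 * x 3 + phi p1 * x 3 ^ 2)"
    "cubic_partial phi (quintic_surface p0 p1 p2 p3 p4) (Suc 0) x =
      2 * x 2 * x 1 + (phi p4 * x 2 ^ 2 + phi p2 * x 2 * x 3 + phi p0 * x 3 ^ 2)"
    "cubic_partial phi (quintic_surface p0 p1 p2 p3 p4) 2 x =
      x 1 ^ 2 + x 0 * (2 * x 2 + phi p3 * x 3) + x 1 * (2 * phi p4 * x 2 + phi p2 * x 3)"
    "cubic_partial phi (quintic_surface p0 p1 p2 p3 p4) 3 x =
      - (x 0 ^ 2) + x 0 * (phi p3 * x 2 + 2 * phi p1 * x 3) + x 1 * (phi p2 * x 2 + 2 * phi p0 * x 3)"
  unfolding cubic_partial_def sum_cubic_monos quintic_surface_def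
  by (simp_all add: assms power2_eq_square algebra_simps)

text \<open>The quintic \<open>X^5 + p4 X^4 + \<dots> + p0 = X C(X^2) + D(X^2)\<close> has simple roots, and the quadratics \<open>C\<close>
  and \<open>D\<close> have no common root.\<close>

locale quintic =
  fixes p0 p1 p2 p3 p4 :: "'k::field_char_0"
  assumes no_common_root:
      "\<And>z. z ^ 2 + to_ac p3 * z + to_ac p1 = 0 \<Longrightarrow> to_ac p4 * z ^ 2 + to_ac p2 * z + to_ac p0 \<noteq> 0"
    and simple_roots:
      "\<And>r. r ^ 5 + to_ac p4 * r ^ 4 + to_ac p3 * r ^ 3 + to_ac p2 * r ^ 2 + to_ac p1 * r + to_ac p0 = 0 \<Longrightarrow>
        5 * r ^ 4 + 4 * to_ac p4 * r ^ 3 + 3 * to_ac p3 * r ^ 2 + 2 * to_ac p2 * r + to_ac p1 \<noteq> 0"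
begin

abbreviation "S \<equiv> quintic_surface p0 p1 p2 p3 p4"

text \<open>In the chart \<open>w = 1\<close> the partials by \<open>x\<close> and \<open>y\<close>
  give \<open>C = 2 u\<close> and \<open>D = - 2 e v\<close>, and the equation becomes
  \<open>u ^ 2 = e * v ^ 2\<close>. If \<open>v = 0\<close>, then \<open>e\<close> is a common root
  of \<open>C\<close> and \<open>D\<close>; otherwise \<open>u / v\<close> is a double root of the
  quintic.\<close>

lemma smooth: "smooth_cubic_surface S"
proof -
  have "False" if nz: "\<exists>i<4. x i \<noteq> 0" and F: "cubic_eval to_ac S x = 0"
    and P: "\<forall>m<4. cubic_partial to_ac S m x = 0" for x :: "nat \<Rightarrow> 'k alg_closure"
  proof -
    note E = F[unfolded cubic_eval_quintic_surface[of to_ac, simplified]]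
      P[rule_format, of 0, unfolded cubic_partial_quintic_surface[of to_ac, simplified], simplified]
      P[rule_format, of "Suc 0", unfolded cubic_partial_quintic_surface[of to_ac, simplified], simplified]
      P[rule_format, of 2, unfolded cubic_partial_quintic_surface[of to_ac, simplified], simplified]
      P[rule_format, of 3, unfolded cubic_partial_quintic_surface[of to_ac, simplified], simplified]
    show False
    proof (cases "x 3 = 0")
      case True
      \<comment> \<open>On \<open>w = 0\<close> the partials by \<open>x\<close>, \<open>z\<close>,
        \<open>w\<close> give in turn \<open>z = 0\<close>, \<open>y = 0\<close>,
        \<open>x = 0\<close>.\<close>
      have "x 2 = 0" "x 1 = 0" "x 0 = 0" using E True by simp_all
      thus False using nz True by (auto simp: less_Suc_eq numeral_eq_Suc)
    next
      case w: False
      define u where "u = x 0 / x 3"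
      define v where "v = x 1 / x 3"
      define e where "e = x 2 / x 3"
      have x: "x 0 = u * x 3" "x (Suc 0) = v * x 3" "x 2 = e * x 3"
        using w by (simp_all add: u_def v_def e_def)
      have "x 3 ^ 2 * (e ^ 2 + to_ac p3 * e + to_ac p1 - 2 * u) = 0"
        using E(2) unfolding x by Groebner_Basis.algebra
      hence C: "e ^ 2 + to_ac p3 * e + to_ac p1 = 2 * u" using w by simp
      have "x 3 ^ 2 * (to_ac p4 * e ^ 2 + to_ac p2 * e + to_ac p0 + 2 * e * v) = 0"
        using E(3) unfolding x by Groebner_Basis.algebra
      hence D: "to_ac p4 * e ^ 2 + to_ac p2 * e + to_ac p0 = - 2 * e * v"
        using w by (simp add: add_eq_0_iff2)
      have "x 3 ^ 2 * (v ^ 2 + u * (2 * e + to_ac p3) + v * (2 * to_ac p4 * e + to_ac p2)) = 0"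
        using E(4) unfolding x by Groebner_Basis.algebra
      hence Pz: "v ^ 2 + u * (2 * e + to_ac p3) + v * (2 * to_ac p4 * e + to_ac p2) = 0"
        using w by simp
      have "x 3 ^ 3 * (e * v ^ 2 - u ^ 2 + u * (2 * u) + v * (- 2 * e * v)) = 0"
        using E(1) unfolding x C[symmetric] D[symmetric] by Groebner_Basis.algebra
      hence "e * v ^ 2 - u ^ 2 + u * (2 * u) + v * (- 2 * e * v) = 0" using w by simp
      hence ue: "u ^ 2 = e * v ^ 2" by Groebner_Basis.algebra
      show False
      proof (cases "v = 0")
        case True
        with ue have "u = 0" by simp
        thus False using no_common_root[of e] C D True by simp
      next
        case v: False
        define r where "r = u / v"
        have u: "u = r * v" using v by (simp add: r_def)
        have "v ^ 2 * (e - r ^ 2) = 0" using ue unfolding u by Groebner_Basis.algebra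
        hence e: "e = r ^ 2" using v by simp
        have "v * (r * (2 * e + to_ac p3) + (2 * to_ac p4 * e + to_ac p2) + v) = 0"
          using Pz unfolding u by Groebner_Basis.algebra
        hence "r * (2 * e + to_ac p3) + (2 * to_ac p4 * e + to_ac p2) + v = 0" using v by simp
        \<comment> \<open>The derivative at \<open>r\<close> is \<open>C + 2 r (r C' + D')\<close>,
          where \<open>C = 2 r v\<close> and \<open>r C' + D' = - v\<close>.\<close>
        hence "5 * r ^ 4 + 4 * to_ac p4 * r ^ 3 + 3 * to_ac p3 * r ^ 2 + 2 * to_ac p2 * r + to_ac p1 = 0"
          using C unfolding u e by Groebner_Basis.algebra
        moreover have "r ^ 5 + to_ac p4 * r ^ 4 + to_ac p3 * r ^ 3 + to_ac p2 * r ^ 2 + to_ac p1 * r + to_ac p0 = 0"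
          using C D unfolding u e by Groebner_Basis.algebra
        ultimately show False using simple_roots by blast
      qed
    qed
  qed
  moreover have "(1, 1, 2) \<in> cubic_monos" "S (1, 1, 2) \<noteq> 0"
    by (simp_all add: cubic_monos_def quintic_surface_def)
  ultimately show ?thesis unfolding smooth_cubic_surface_def by blast
qed

section \<open>The lines on the quintic surface\<close>

definition roots :: "'k set" where
  "roots = {s. s ^ 5 + p4 * s ^ 4 + p3 * s ^ 3 + p2 * s ^ 2 + p1 * s + p0 = 0}"

text \<open>Pairs \<open>(h1, h0)\<close> for which \<open>X^2 + h1 X + h0\<close> divides the quintic with quotient
  \<open>X^3 + g2 X^2 + g1 X + g0\<close>.\<close>

definition g2 :: "'k \<times> 'k \<Rightarrow> 'k" where "g2 = (\<lambda>(h1, h0). p4 - h1)"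
definition g1 :: "'k \<times> 'k \<Rightarrow> 'k" where "g1 = (\<lambda>(h1, h0). p3 - h0 - h1 * g2 (h1, h0))"
definition g0 :: "'k \<times> 'k \<Rightarrow> 'k" where "g0 = (\<lambda>(h1, h0). p2 - h1 * g1 (h1, h0) - h0 * g2 (h1, h0))"

definition quads :: "('k \<times> 'k) set" where
  "quads = {(h1, h0). p1 = h1 * g0 (h1, h0) + h0 * g1 (h1, h0) \<and> p0 = h0 * g0 (h1, h0)}"

text \<open>For a root \<open>s\<close> one has \<open>D = - s C\<close> at
  \<open>(z : w) = (s^2 : 1)\<close>, so the plane \<open>z = s^2 w\<close> cuts the surface in the
  edge and the lines \<open>x = s y\<close> and \<open>x = - s y + C w\<close>. These are
  \<open>line_A s\<close> and \<open>line_B s\<close>.\<close>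

definition line_A :: "'k \<Rightarrow> (nat \<Rightarrow> 'k) set" where
  "line_A s = meeting_line s 0 (s ^ 2)"

definition line_B :: "'k \<Rightarrow> (nat \<Rightarrow> 'k) set" where
  "line_B s = meeting_line (- s) (s ^ 4 + p3 * s ^ 2 + p1) (s ^ 2)"

text \<open>The plane \<open>x = s y\<close> cuts the surface in \<open>x = y = 0\<close>, in
  \<open>line_A s\<close> and in this line: for a root \<open>s\<close>, the form
  \<open>s C + D\<close> is \<open>z - s^2 w\<close> times
  \<open>- \<gamma> z - \<delta> w\<close>.\<close>

definition line_R :: "'k \<Rightarrow> (nat \<Rightarrow> 'k) set" where
  "line_R s = (let \<gamma> = - (s + p4); \<delta> = - (s ^ 3 + p4 * s ^ 2 + p3 * s + p2)
    in graph_line (s * \<gamma>) (s * \<delta>) \<gamma> \<delta>)"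

text \<open>On a line \<open>x = \<alpha> z + \<beta> w, y = \<gamma> z + \<delta> w\<close> disjoint from \<open>x = y = 0\<close>, the form \<open>z - s^2 w\<close> vanishes at
  the point with \<open>(x : y) = (s : 1)\<close> iff \<open>s\<close> is a root of
  \<open>X^3 - (\<alpha> / \<gamma>) X^2 + (\<delta> / \<gamma>) X - \<beta> / \<gamma>\<close>. The line \<open>line_Q h\<close> is the one for which this cubic is the
  cofactor of the quadratic factor \<open>h\<close>.\<close>

definition line_Q :: "'k \<times> 'k \<Rightarrow> (nat \<Rightarrow> 'k) set" where
  "line_Q h = graph_line (g2 h * fst h) (g0 h * fst h) (- fst h) (- g1 h * fst h)"

lemma eval_S:
  "cubic_eval id S (v4 x y z w) = z * y ^ 2 - w * x ^ 2 + x * (z ^ 2 + p3 * z * w + p1 * w ^ 2)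
    + y * (p4 * z ^ 2 + p2 * z * w + p0 * w ^ 2)"
  by (simp add: cubic_eval_quintic_surface)

lemma no_common_root': "z ^ 2 + p3 * z + p1 = 0 \<Longrightarrow> p4 * z ^ 2 + p2 * z + p0 \<noteq> 0"
proof -
  assume "z ^ 2 + p3 * z + p1 = 0"
  hence "to_ac (z ^ 2 + p3 * z + p1) = 0" by (simp only: to_ac_0)
  hence "to_ac (p4 * z ^ 2 + p2 * z + p0) \<noteq> 0" using no_common_root[of "to_ac z"] by simp
  thus ?thesis by (metis to_ac_0)
qed

lemma edge_on_S: "line_on_surface S edge_line"
  using line_on_surface_v4[of S 1 0 0 0 0 1 0 0] is_line_edge_line
  by (simp add: edge_line_def eval_S)

lemma graph_on_S:
  "line_on_surface S (graph_line \<alpha> \<beta> \<gamma> \<delta>) \<longleftrightarrow>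
    \<gamma> ^ 2 + \<alpha> + p4 * \<gamma> = 0 \<and>
    2 * \<gamma> * \<delta> - \<alpha> ^ 2 + \<beta> + p3 * \<alpha> + p4 * \<delta> + p2 * \<gamma> = 0 \<and>
    \<delta> ^ 2 - 2 * \<alpha> * \<beta> + p3 * \<beta> + p1 * \<alpha> + p2 * \<delta> + p0 * \<gamma> = 0 \<and>
    - (\<beta> ^ 2) + p1 * \<beta> + p0 * \<delta> = 0" (is "_ \<longleftrightarrow> ?a = 0 \<and> ?b = 0 \<and> ?c = 0 \<and> ?d = 0")
proof -
  have eval: "cubic_eval id S (v4 (s * \<alpha> + t * \<beta>) (s * \<gamma> + t * \<delta>) (s * 1 + t * 0) (s * 0 + t * 1))
    = s ^ 3 * ?a + s ^ 2 * t * ?b + s * t ^ 2 * ?c + t ^ 3 * ?d" for s t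
    unfolding eval_S by (simp add: algebra_simps power2_eq_square power3_eq_cube)
  have *: "line_on_surface S (graph_line \<alpha> \<beta> \<gamma> \<delta>) \<longleftrightarrow>
    (\<forall>s t. s ^ 3 * ?a + s ^ 2 * t * ?b + s * t ^ 2 * ?c + t ^ 3 * ?d = 0)"
    unfolding graph_line_def line_on_surface_v4 eval
    using is_line_graph_line[of \<alpha> \<beta> \<gamma> \<delta>] by (simp add: graph_line_def)
  show ?thesis unfolding * by (rule binary_cubic_zero_iff)
qed

lemma meeting_on_S:
  "line_on_surface S (meeting_line s x z) \<longleftrightarrow> z = s ^ 2 \<and>
    - 2 * s * x + s * (z ^ 2 + p3 * z + p1) + (p4 * z ^ 2 + p2 * z + p0) = 0 \<and>
    - (x ^ 2) + x * (z ^ 2 + p3 * z + p1) = 0" (is "_ \<longleftrightarrow> _ \<and> ?c = 0 \<and> ?d = 0")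
proof -
  have eval: "cubic_eval id S (v4 (t * s + u * x) (t * 1 + u * 0) (t * 0 + u * z) (t * 0 + u * 1))
    = t ^ 3 * 0 + t ^ 2 * u * (z - s ^ 2) + t * u ^ 2 * ?c + u ^ 3 * ?d" for t u
    unfolding eval_S by (simp add: algebra_simps power2_eq_square power3_eq_cube)
  have "line_on_surface S (meeting_line s x z) \<longleftrightarrow>
    (\<forall>t u. t ^ 3 * 0 + t ^ 2 * u * (z - s ^ 2) + t * u ^ 2 * ?c + u ^ 3 * ?d = 0)"
    unfolding meeting_line_def line_on_surface_v4 eval
    using is_line_meeting_line[of s x z] by (simp add: meeting_line_def)
  also have "\<dots> \<longleftrightarrow> 0 = (0::'k) \<and> z - s ^ 2 = 0 \<and> ?c = 0 \<and> ?d = 0"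
    by (rule binary_cubic_zero_iff)
  finally show ?thesis by simp
qed

lemma line_A_on_S: "s \<in> roots \<Longrightarrow> line_on_surface S (line_A s)"
  unfolding line_A_def meeting_on_S roots_def
  by (auto simp: algebra_simps power_mult_distrib simp flip: power_mult) (simp add: eval_nat_numeral algebra_simps)

lemma line_B_on_S:
  assumes "s \<in> roots"
  shows "line_on_surface S (line_B s)"
proof -
  have "s ^ 5 + p4 * s ^ 4 + p3 * s ^ 3 + p2 * s ^ 2 + p1 * s + p0 = 0"
    using assms by (simp add: roots_def)
  thus ?thesis
    unfolding line_B_def meeting_on_S by - (intro conjI; (Groebner_Basis.algebra | simp add: eval_nat_numeral algebra_simps))
qed

text \<open>The coefficient of \<open>t ^ 2 * u\<close> places the line in the plane
  \<open>z = s^2 w\<close>, where \<open>(s : 1 : 0 : 0)\<close> is its point on the edge. The last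
  coefficient leaves only \<open>0\<close> and \<open>C\<close> for \<open>x'\<close>, the two
  residual lines of that plane.\<close>

lemma meeting_edge_cases:
  assumes on: "line_on_surface S (span2 (v4 a b 0 0) (v4 x y z w))"
    and nz: "a \<noteq> 0 \<or> b \<noteq> 0" "z \<noteq> 0 \<or> w \<noteq> 0"
  shows "\<exists>s\<in>roots. span2 (v4 a b 0 0) (v4 x y z w) = line_A s \<or> span2 (v4 a b 0 0) (v4 x y z w) = line_B s"
proof -
  let ?c = "2 * (z * b * y - w * a * x) + a * (z ^ 2 + p3 * z * w + p1 * w ^ 2) + b * (p4 * z ^ 2 + p2 * z * w + p0 * w ^ 2)"
  let ?d = "z * y ^ 2 - w * x ^ 2 + x * (z ^ 2 + p3 * z * w + p1 * w ^ 2) + y * (p4 * z ^ 2 + p2 * z * w + p0 * w ^ 2)"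
  have "cubic_eval id S (v4 (t * a + u * x) (t * b + u * y) (t * 0 + u * z) (t * 0 + u * w))
    = t ^ 3 * 0 + t ^ 2 * u * (z * b ^ 2 - w * a ^ 2) + t * u ^ 2 * ?c + u ^ 3 * ?d" for t u
    unfolding eval_S by (simp add: algebra_simps power2_eq_square power3_eq_cube)
  hence "\<forall>t u. t ^ 3 * 0 + t ^ 2 * u * (z * b ^ 2 - w * a ^ 2) + t * u ^ 2 * ?c + u ^ 3 * ?d = 0"
    using on unfolding line_on_surface_v4 by simp
  hence eqs: "z * b ^ 2 - w * a ^ 2 = 0" "?c = 0"
    unfolding binary_cubic_zero_iff by auto
  have b: "b \<noteq> 0"
  proof
    assume "b = 0"
    with nz(1) eqs(1) have "a \<noteq> 0" "w = 0" by auto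
    with eqs(2) \<open>b = 0\<close> have "a * z ^ 2 = 0" by simp
    with \<open>a \<noteq> 0\<close> \<open>w = 0\<close> nz(2) show False by simp
  qed
  have w: "w \<noteq> 0" using eqs(1) b nz(2) by auto
  obtain s x' z' where L: "span2 (v4 a b 0 0) (v4 x y z w) = meeting_line s x' z'"
    using meeting_line_eq[OF b w] by blast
  have "z' = s ^ 2 \<and> - 2 * s * x' + s * (z' ^ 2 + p3 * z' + p1) + (p4 * z' ^ 2 + p2 * z' + p0) = 0
    \<and> - (x' ^ 2) + x' * (z' ^ 2 + p3 * z' + p1) = 0"
    using on unfolding L meeting_on_S .
  moreover have "x' * (z' ^ 2 + p3 * z' + p1 - x') = - (x' ^ 2) + x' * (z' ^ 2 + p3 * z' + p1)"
    by (simp add: algebra_simps power2_eq_square)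
  ultimately have z: "z' = s ^ 2" and
    e: "- 2 * s * x' + s * (z' ^ 2 + p3 * z' + p1) + (p4 * z' ^ 2 + p2 * z' + p0) = 0"
      "x' * (z' ^ 2 + p3 * z' + p1 - x') = 0"
    by metis+
  from e(2) consider "x' = 0" | "x' = z' ^ 2 + p3 * z' + p1" by auto
  thus ?thesis
  proof cases
    case 1
    have "s \<in> roots" using e(1) unfolding roots_def z 1 mem_Collect_eq by Groebner_Basis.algebra
    thus ?thesis unfolding L line_A_def 1 z by blast
  next
    case 2
    \<comment> \<open>With parameter \<open>s\<close>, \<open>line_B\<close> meets the edge at
      \<open>(- s : 1 : 0 : 0)\<close>; hence the sign.\<close>
    have "- s \<in> roots" using e(1) unfolding roots_def z 2 mem_Collect_eq by Groebner_Basis.algebra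
    moreover have "meeting_line s x' z' = line_B (- s)"
      unfolding line_B_def 2 z by (simp flip: power_mult)
    ultimately show ?thesis unfolding L by blast
  qed
qed

lemma line_R_on_S:
  assumes "s \<in> roots"
  shows "line_on_surface S (line_R s)"
proof -
  have "s ^ 5 + p4 * s ^ 4 + p3 * s ^ 3 + p2 * s ^ 2 + p1 * s + p0 = 0"
    using assms by (simp add: roots_def)
  thus ?thesis
    unfolding line_R_def Let_def graph_on_S by - (intro conjI; (Groebner_Basis.algebra | simp add: eval_nat_numeral algebra_simps))
qed

lemma line_Q_on_S:
  assumes "h \<in> quads"
  shows "line_on_surface S (line_Q h)"
proof -
  obtain h1 h0 where h: "h = (h1, h0)" by fastforce
  define G2 where "G2 = g2 h"
  define G1 where "G1 = g1 h"
  define G0 where "G0 = g0 h"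
  \<comment> \<open>Expressing the quintic through its two factors turns the conditions for the line
    into polynomial identities.\<close>
  have eqs: "p4 = G2 + h1" "p3 = G1 + h0 + h1 * G2" "p2 = G0 + h1 * G1 + h0 * G2"
    "p1 = h1 * G0 + h0 * G1" "p0 = h0 * G0"
    using assms by (auto simp: G2_def G1_def G0_def h quads_def) (simp_all add: g0_def g1_def g2_def)
  show ?thesis
    unfolding line_Q_def graph_on_S G2_def[symmetric] G1_def[symmetric] G0_def[symmetric]
    unfolding h fst_conv eqs by - (intro conjI; (Groebner_Basis.algebra | simp add: eval_nat_numeral algebra_simps))
qed

text \<open>\<open>\<alpha> * \<delta> = \<beta> * \<gamma>\<close> means that the line meets or
  equals \<open>x = y = 0\<close>; if it is different, it lies in a plane \<open>x = s y\<close> and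
  is \<open>line_R s\<close>. Any other line has \<open>\<gamma> \<noteq> 0\<close>, and the ratios
  of its parameters to \<open>\<gamma>\<close> form a cubic that is shown to divide the
  quintic.\<close>

lemma graph_cases:
  assumes on: "line_on_surface S (graph_line \<alpha> \<beta> \<gamma> \<delta>)"
  shows "graph_line \<alpha> \<beta> \<gamma> \<delta> = graph_line 0 0 0 0 \<or>
    (\<exists>s\<in>roots. graph_line \<alpha> \<beta> \<gamma> \<delta> = line_R s) \<or> (\<exists>h\<in>quads. graph_line \<alpha> \<beta> \<gamma> \<delta> = line_Q h)"
proof -
  note eqs = on[unfolded graph_on_S]
  have a: "\<gamma> ^ 2 + \<alpha> + p4 * \<gamma> = 0"
    and b: "2 * \<gamma> * \<delta> - \<alpha> ^ 2 + \<beta> + p3 * \<alpha> + p4 * \<delta> + p2 * \<gamma> = 0"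
    and c: "\<delta> ^ 2 - 2 * \<alpha> * \<beta> + p3 * \<beta> + p1 * \<alpha> + p2 * \<delta> + p0 * \<gamma> = 0"
    and d: "- (\<beta> ^ 2) + p1 * \<beta> + p0 * \<delta> = 0"
    using eqs by blast+
  show ?thesis
  proof (cases "\<gamma> = 0")
    case \<gamma>: True
    \<comment> \<open>Here either the line is \<open>x = y = 0\<close> or it has
      \<open>s = - p4\<close>.\<close>
    have \<alpha>: "\<alpha> = 0" using a \<gamma> by simp
    have \<beta>: "\<beta> = - p4 * \<delta>" using b \<gamma> \<alpha> by Groebner_Basis.algebra
    show ?thesis
    proof (cases "\<delta> = 0")
      case True
      thus ?thesis using \<alpha> \<beta> \<gamma> by simp
    next
      case False
      have "\<delta> * (\<delta> - (p3 * p4 - p2)) = 0" using c unfolding \<alpha> \<beta> \<gamma> by Groebner_Basis.algebra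
      hence \<delta>: "\<delta> = p3 * p4 - p2" using False by simp
      have "\<delta> * (- (p4 ^ 2) * \<delta> - p1 * p4 + p0) = 0" using d unfolding \<beta> by Groebner_Basis.algebra
      hence "- (p4 ^ 2) * \<delta> - p1 * p4 + p0 = 0" using False by simp
      hence "- p4 \<in> roots" unfolding \<delta> roots_def mem_Collect_eq by Groebner_Basis.algebra
      moreover have "graph_line \<alpha> \<beta> \<gamma> \<delta> = line_R (- p4)"
        unfolding line_R_def Let_def graph_line_inject \<alpha> \<beta> \<gamma> \<delta> by - (intro conjI; (Groebner_Basis.algebra | simp add: eval_nat_numeral algebra_simps))
      ultimately show ?thesis by blast
    qed
  next
    case \<gamma>: False
    show ?thesis
    proof (cases "\<alpha> * \<delta> = \<beta> * \<gamma>")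
      case True
      define s where "s = \<alpha> / \<gamma>"
      have \<alpha>: "\<alpha> = s * \<gamma>" and \<beta>: "\<beta> = s * \<delta>"
        using True \<gamma> by (simp_all add: s_def field_simps)
      have "\<gamma> * (\<gamma> + s + p4) = 0" using a unfolding \<alpha> by Groebner_Basis.algebra
      hence \<gamma>': "\<gamma> = - (s + p4)" using \<gamma> by (simp add: add_eq_0_iff2 add.assoc)
      have "\<gamma> * (\<delta> + s ^ 3 + p4 * s ^ 2 + p3 * s + p2) = 0"
        using b \<gamma>' unfolding \<alpha> \<beta> by Groebner_Basis.algebra
      hence "\<delta> + s ^ 3 + p4 * s ^ 2 + p3 * s + p2 = 0" using \<gamma> by simp
      hence \<delta>: "\<delta> = - (s ^ 3 + p4 * s ^ 2 + p3 * s + p2)" by Groebner_Basis.algebra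
      have "\<gamma> * (s ^ 5 + p4 * s ^ 4 + p3 * s ^ 3 + p2 * s ^ 2 + p1 * s + p0) = 0"
        using c \<delta> \<gamma>' unfolding \<alpha> \<beta> by Groebner_Basis.algebra
      hence "s \<in> roots" using \<gamma> by (simp add: roots_def)
      moreover have "graph_line \<alpha> \<beta> \<gamma> \<delta> = line_R s"
        unfolding line_R_def Let_def graph_line_inject \<alpha> \<beta> using \<gamma>' \<delta> by simp
      ultimately show ?thesis by blast
    next
      case False
      define G1 where "G1 = \<delta> / \<gamma>"
      define G0 where "G0 = - \<beta> / \<gamma>"
      have \<delta>: "\<delta> = \<gamma> * G1" and \<beta>: "\<beta> = - \<gamma> * G0"
        using \<gamma> by (simp_all add: G1_def G0_def)
      have \<alpha>: "\<alpha> = - \<gamma> * (\<gamma> + p4)" using a by Groebner_Basis.algebra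
      \<comment> \<open>Chosen so that the quintic and the product of
        \<open>X^2 - \<gamma> X + h0\<close> with the cubic agree at \<open>X^3\<close>.\<close>
      define h0 where "h0 = p3 + \<gamma> * (p4 + \<gamma>) - G1"
      have G2: "g2 (- \<gamma>, h0) = p4 + \<gamma>" by (simp add: g2_def)
      have G1: "g1 (- \<gamma>, h0) = G1"
        unfolding g1_def prod.case G2 unfolding h0_def by (simp add: algebra_simps)
      have "\<gamma> * (p2 + \<gamma> * G1 - h0 * (p4 + \<gamma>) - G0) = 0"
        using b unfolding \<alpha> \<beta> \<delta> h0_def by Groebner_Basis.algebra
      hence p2': "p2 + \<gamma> * G1 - h0 * (p4 + \<gamma>) - G0 = 0" using \<gamma> by simp
      hence G0: "g0 (- \<gamma>, h0) = G0"
        unfolding g0_def prod.case G2 G1 by simp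
      \<comment> \<open>Subtracting that product from the quintic leaves
        \<open>e1 X + e0\<close>.\<close>
      define e1 where "e1 = p1 + \<gamma> * G0 - h0 * G1"
      define e0 where "e0 = p0 - h0 * G0"
      have p2: "p2 = G0 - \<gamma> * G1 + h0 * (p4 + \<gamma>)"
        using p2' by Groebner_Basis.algebra
      have "\<gamma> * (e1 * (p4 + \<gamma>) - e0) = 0"
        using c p2 unfolding \<alpha> \<beta> \<delta> e1_def e0_def h0_def by Groebner_Basis.algebra
      hence e: "e0 = e1 * (p4 + \<gamma>)" using \<gamma> by simp
      have "\<gamma> * (e1 * G0 - e0 * G1) = 0"
        using d unfolding \<beta> \<delta> e1_def e0_def by Groebner_Basis.algebra
      hence "\<gamma> * (e1 * (G0 - (p4 + \<gamma>) * G1)) = 0" unfolding e by Groebner_Basis.algebra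
      hence "e1 * (G0 - (p4 + \<gamma>) * G1) = 0" using \<gamma> by simp
      \<comment> \<open>This is \<open>\<alpha> * \<delta> - \<beta> * \<gamma>\<close> divided by
        \<open>\<gamma> ^ 2\<close>.\<close>
      moreover have "G0 - (p4 + \<gamma>) * G1 \<noteq> 0"
        using False unfolding \<alpha> \<beta> \<delta> by (auto simp: algebra_simps)
      ultimately have "e1 = 0" "e0 = 0" using e by simp_all
      hence "(- \<gamma>, h0) \<in> quads"
        unfolding quads_def by (simp add: G0 G1 e1_def e0_def algebra_simps)
      moreover have "graph_line \<alpha> \<beta> \<gamma> \<delta> = line_Q (- \<gamma>, h0)"
        unfolding line_Q_def G2 G1 G0 graph_line_inject \<alpha> \<beta> \<delta> by simp
      ultimately show ?thesis by blast
    qed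
  qed
qed

text \<open>If \<open>h1 = 0\<close>, then \<open>X^2 + h0\<close> divides the quintic and
  \<open>- h0\<close> is a root of both \<open>C\<close> and \<open>D\<close>. If
  \<open>g0 = g1 * g2\<close>, the cofactor is \<open>(X^2 + g1) (X + g2)\<close> and the same
  happens at \<open>- g1\<close>.\<close>

lemma quads_nondegenerate:
  assumes h: "(h1, h0) \<in> quads"
  shows "h1 \<noteq> 0" "g0 (h1, h0) \<noteq> g1 (h1, h0) * g2 (h1, h0)"
proof -
  define G2 where "G2 = g2 (h1, h0)"
  define G1 where "G1 = g1 (h1, h0)"
  define G0 where "G0 = g0 (h1, h0)"
  have eqs: "p4 = G2 + h1" "p3 = G1 + h0 + h1 * G2" "p2 = G0 + h1 * G1 + h0 * G2"
    "p1 = h1 * G0 + h0 * G1" "p0 = h0 * G0"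
    using assms by (auto simp: G2_def G1_def G0_def quads_def) (simp_all add: g0_def g1_def g2_def)
  show "h1 \<noteq> 0"
  proof
    assume "h1 = 0"
    thus False using no_common_root'[of "- h0"] unfolding eqs by (simp add: algebra_simps power2_eq_square)
  qed
  show "G0 \<noteq> G1 * G2"
  proof
    assume "G0 = G1 * G2"
    thus False using no_common_root'[of "- G1"] unfolding eqs by (simp add: algebra_simps power2_eq_square)
  qed
qed

lemma lines_on_S:
  "{L. line_on_surface S L} =
    ({edge_line} \<union> (line_A ` roots \<union> line_B ` roots)) \<union> ({graph_line 0 0 0 0} \<union> (line_R ` roots \<union> line_Q ` quads))"
proof (intro equalityI subsetI)
  fix L assume "L \<in> {L. line_on_surface S L}"
  hence on: "line_on_surface S L" by simp
  hence "is_line L" unfolding line_on_surface_iff by blast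
  thus "L \<in> ({edge_line} \<union> (line_A ` roots \<union> line_B ` roots)) \<union> ({graph_line 0 0 0 0} \<union> (line_R ` roots \<union> line_Q ` quads))"
  proof (cases rule: is_line_cases)
    case edge
    thus ?thesis by simp
  next
    case (meets a b x y z w)
    thus ?thesis using meeting_edge_cases[of a b x y z w] on by auto
  next
    case (graph \<alpha> \<beta> \<gamma> \<delta>)
    thus ?thesis using graph_cases[of \<alpha> \<beta> \<gamma> \<delta>] on by auto
  qed
next
  fix L assume "L \<in> ({edge_line} \<union> (line_A ` roots \<union> line_B ` roots)) \<union> ({graph_line 0 0 0 0} \<union> (line_R ` roots \<union> line_Q ` quads))"
  moreover have "line_on_surface S (graph_line 0 0 0 0)" by (simp add: graph_on_S)
  ultimately show "L \<in> {L. line_on_surface S L}"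
    using edge_on_S line_A_on_S line_B_on_S line_R_on_S line_Q_on_S by blast
qed

section \<open>Distinctness and number of the lines\<close>

lemma line_A_inject: "line_A s = line_A s' \<longleftrightarrow> s = s'"
  by (auto simp: line_A_def meeting_line_inject)

lemma line_B_inject: "line_B s = line_B s' \<longleftrightarrow> s = s'"
  by (auto simp: line_B_def meeting_line_inject)

text \<open>Equality makes \<open>C\<close> vanish at \<open>s' ^ 2\<close>; as \<open>s'\<close> is
  a root of the quintic, \<open>D\<close> vanishes there too.\<close>

lemma line_A_neq_line_B:
  assumes "s' \<in> roots"
  shows "line_A s \<noteq> line_B s'"
proof
  assume "line_A s = line_B s'"
  hence "s' ^ 4 + p3 * s' ^ 2 + p1 = 0"
    by (simp add: line_A_def line_B_def meeting_line_inject)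
  moreover have "s' ^ 5 + p4 * s' ^ 4 + p3 * s' ^ 3 + p2 * s' ^ 2 + p1 * s' + p0 = 0"
    using assms by (simp add: roots_def)
  ultimately have "(s' ^ 2) ^ 2 + p3 * s' ^ 2 + p1 = 0" "p4 * (s' ^ 2) ^ 2 + p2 * s' ^ 2 + p0 = 0"
    by Groebner_Basis.algebra+
  thus False using no_common_root'[of "s' ^ 2"] by simp
qed

lemma line_R_inject: "line_R s = line_R s' \<longleftrightarrow> s = s'"
  by (auto simp: line_R_def Let_def graph_line_inject)

text \<open>Equality makes \<open>D = - s C\<close> as polynomials, so any root of \<open>C\<close>
  in the algebraic closure is a common root.\<close>

lemma line_R_neq_0:
  assumes s: "s \<in> roots"
  shows "line_R s \<noteq> graph_line 0 0 0 0"
proof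
  assume "line_R s = graph_line 0 0 0 0"
  hence "- (s + p4) = 0" "- (s ^ 3 + p4 * s ^ 2 + p3 * s + p2) = 0"
    unfolding line_R_def Let_def graph_line_inject by blast+
  hence "s + p4 = 0" "s ^ 3 + p4 * s ^ 2 + p3 * s + p2 = 0"
    by (simp_all only: neg_equal_0_iff_equal)
  moreover have "s ^ 5 + p4 * s ^ 4 + p3 * s ^ 3 + p2 * s ^ 2 + p1 * s + p0 = 0"
    using s by (simp add: roots_def)
  ultimately have "p4 = - s" "p2 = - s * p3" "p0 = - s * p1" by Groebner_Basis.algebra+
  hence D: "to_ac p4 * z ^ 2 + to_ac p2 * z + to_ac p0 = - to_ac s * (z ^ 2 + to_ac p3 * z + to_ac p1)" for z
    by (simp add: algebra_simps)
  obtain z where z: "poly [:to_ac p1, to_ac p3, 1:] z = 0"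
    using alg_closed_imp_poly_has_root[of "[:to_ac p1, to_ac p3, 1:]"] by auto
  hence "z ^ 2 + to_ac p3 * z + to_ac p1 = 0" by (simp add: algebra_simps power2_eq_square)
  thus False using no_common_root[of z] D[of z] by simp
qed

lemma line_Q_inject:
  assumes "h \<in> quads" "h' \<in> quads" "line_Q h = line_Q h'"
  shows "h = h'"
proof -
  obtain h1 h0 h1' h0' where h: "h = (h1, h0)" "h' = (h1', h0')" by fastforce
  have eq: "h1 = h1'" using assms(3) by (simp add: line_Q_def graph_line_inject h)
  have nz: "h1' \<noteq> 0" using quads_nondegenerate(1) assms(2) h by blast
  have "g1 (h1', h0) = g1 (h1', h0')"
    using assms(3) nz by (simp add: line_Q_def graph_line_inject h eq)
  thus ?thesis by (simp add: g1_def g2_def h eq)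
qed

text \<open>By \<open>quads_nondegenerate\<close> the line \<open>line_Q h\<close> is disjoint from
  \<open>x = y = 0\<close>, and the other line is not.\<close>

lemma line_Q_neq_graph_degenerate:
  assumes "h \<in> quads" "\<alpha> * \<delta> = \<beta> * \<gamma>"
  shows "line_Q h \<noteq> graph_line \<alpha> \<beta> \<gamma> \<delta>"
proof
  assume eq: "line_Q h = graph_line \<alpha> \<beta> \<gamma> \<delta>"
  obtain h1 h0 where h: "h = (h1, h0)" by fastforce
  have nz: "h1 \<noteq> 0" "g0 h \<noteq> g1 h * g2 h" using quads_nondegenerate assms(1) unfolding h by blast+
  have e: "\<alpha> = g2 h * h1" "\<beta> = g0 h * h1" "\<gamma> = - h1" "\<delta> = - g1 h * h1"
    using eq by (simp_all add: line_Q_def graph_line_inject h)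
  have "h1 ^ 2 * (g0 h - g1 h * g2 h) = 0" using assms(2) unfolding e by Groebner_Basis.algebra
  thus False using nz by simp
qed

lemma line_Q_neq_line_R: "h \<in> quads \<Longrightarrow> line_Q h \<noteq> line_R s"
  unfolding line_R_def Let_def by (rule line_Q_neq_graph_degenerate) (simp_all add: algebra_simps)

text \<open>Each root contributes one line to each of the families A, B, R. With five rational roots
  the count is \<open>2 + 15 + 10 = 27\<close>.\<close>

lemma card_lines_on_S:
  assumes fin: "finite roots" "finite quads"
  shows "finite {L. line_on_surface S L}"
    "card {L. line_on_surface S L} = 2 + 3 * card roots + card quads"
proof -
  show "finite {L. line_on_surface S L}" unfolding lines_on_S using fin by simp
  have AB: "card (line_A ` roots \<union> line_B ` roots) = card roots + card roots"
    using fin line_A_neq_line_B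
    by (subst card_Un_disjoint) (auto simp: card_image inj_on_def line_A_inject line_B_inject)
  have 1: "card ({edge_line} \<union> (line_A ` roots \<union> line_B ` roots)) = 1 + 2 * card roots"
    using fin AB edge_line_neq(1)
    by (subst card_Un_disjoint) (auto simp: line_A_def line_B_def edge_line_neq)
  have RQ: "card (line_R ` roots \<union> line_Q ` quads) = card roots + card quads"
  proof (subst card_Un_disjoint)
    have "inj_on line_Q quads" by (rule inj_onI) (rule line_Q_inject)
    thus "card (line_R ` roots) + card (line_Q ` quads) = card roots + card quads"
      by (simp add: card_image inj_on_def line_R_inject)
    show "line_R ` roots \<inter> line_Q ` quads = {}" using line_Q_neq_line_R by blast
  qed (use fin in auto)
  have "graph_line 0 0 0 0 \<notin> line_R ` roots \<union> line_Q ` quads"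
    using line_R_neq_0 line_Q_neq_graph_degenerate[of _ 0 0 0 0] by (auto dest: sym)
  hence 2: "card ({graph_line 0 0 0 0} \<union> (line_R ` roots \<union> line_Q ` quads)) = 1 + card roots + card quads"
    using fin RQ by simp
  have "({edge_line} \<union> (line_A ` roots \<union> line_B ` roots)) \<inter>
    ({graph_line 0 0 0 0} \<union> (line_R ` roots \<union> line_Q ` quads)) = {}"
    by (auto simp: edge_line_neq edge_line_neq[symmetric] meeting_line_neq_graph_line
        meeting_line_neq_graph_line[symmetric] line_A_def line_B_def line_R_def line_Q_def Let_def)
  hence "card {L. line_on_surface S L} = (1 + 2 * card roots) + (1 + card roots + card quads)"
    unfolding lines_on_S using fin by (subst card_Un_disjoint) (auto simp: 1[simplified] 2[simplified])
  thus "card {L. line_on_surface S L} = 2 + 3 * card roots + card quads" by simp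
qed

end

section \<open>Surfaces with at most one line\<close>

text \<open>Modulo the norm form \<open>N\<close> of \<open>k(\<theta>)/k\<close>, \<open>\<theta>^3 = c\<close>, the coordinates \<open>u, v, t\<close> of the adjoint of
  \<open>x + y \<theta> + z \<theta>^2\<close> satisfy \<open>v^2 = u t\<close> and \<open>c t^2 = u v\<close>.\<close>

lemma norm_form_anisotropic:
  fixes x y z c :: "'a::field"
  assumes N: "x ^ 3 + c * y ^ 3 + c ^ 2 * z ^ 3 - 3 * c * x * y * z = 0" and c: "\<And>a. a ^ 3 \<noteq> c"
  shows "x = 0" "y = 0" "z = 0"
proof -
  define u where "u = x ^ 2 - c * y * z"
  define v where "v = c * z ^ 2 - x * y"
  define t where "t = y ^ 2 - x * z"
  have vut: "v ^ 2 = u * t" and ctv: "c * t ^ 2 = u * v"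
    using N unfolding u_def v_def t_def by Groebner_Basis.algebra+
  have cube0: "a = 0" if "b ^ 3 = c * a ^ 3" for a b :: 'a
  proof (rule ccontr)
    assume "a \<noteq> 0"
    hence "(b / a) ^ 3 = c" using that by (simp add: power_divide)
    thus False using c by blast
  qed
  \<comment> \<open>If the common factor were nonzero, then \<open>v = t = 0\<close>, which makes it
    zero.\<close>
  have "v * (v ^ 3 - c * t ^ 3) = 0" "t * (v ^ 3 - c * t ^ 3) = 0"
    using vut ctv by Groebner_Basis.algebra+
  hence "v ^ 3 = c * t ^ 3" by auto
  hence t: "t = 0" by (rule cube0)
  hence v: "v = 0" using vut by simp
  have "y ^ 3 = c * z ^ 3" using t v unfolding t_def v_def by Groebner_Basis.algebra
  thus z: "z = 0" by (rule cube0)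
  show y: "y = 0" using t z by (simp add: t_def)
  show "x = 0" using N y z by simp
qed

text \<open>The form \<open>N(x, y, z) + w^3 + w x^2\<close>. Without the last term the surface
  would be singular where \<open>w\<close> and two of the geometric linear factors of
  \<open>N\<close> vanish.\<close>

definition norm_surface :: "'a::field \<Rightarrow> nat \<times> nat \<times> nat \<Rightarrow> 'a" where
  "norm_surface c = (\<lambda>_. 0)
    ((0,0,0) := 1, (1,1,1) := c, (2,2,2) := c ^ 2, (0,1,2) := - 3 * c, (3,3,3) := 1, (0,0,3) := 1)"

lemma cubic_eval_norm_surface:
  assumes "phi 0 = 0" "phi 1 = 1" "phi (- 3 * c) = - 3 * phi c" "phi (c ^ 2) = phi c ^ 2"
  shows "cubic_eval phi (norm_surface c) x =
    x 0 ^ 3 + phi c * x 1 ^ 3 + phi c ^ 2 * x 2 ^ 3 - 3 * phi c * x 0 * x 1 * x 2 + x 3 ^ 3 + x 3 * x 0 ^ 2"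
  unfolding cubic_eval_def sum_cubic_monos norm_surface_def
  using assms by (simp add: power2_eq_square power3_eq_cube algebra_simps)

lemma cubic_partial_norm_surface:
  assumes "phi 0 = 0" "phi 1 = 1" "phi (- 3 * c) = - 3 * phi c" "phi (c ^ 2) = phi c ^ 2"
  shows "cubic_partial phi (norm_surface c) 0 x = 3 * x 0 ^ 2 - 3 * phi c * x 1 * x 2 + 2 * x 3 * x 0"
    "cubic_partial phi (norm_surface c) (Suc 0) x = 3 * phi c * x 1 ^ 2 - 3 * phi c * x 0 * x 2"
    "cubic_partial phi (norm_surface c) 2 x = 3 * phi c ^ 2 * x 2 ^ 2 - 3 * phi c * x 0 * x 1"
    "cubic_partial phi (norm_surface c) 3 x = 3 * x 3 ^ 2 + x 0 ^ 2"
  unfolding cubic_partial_def sum_cubic_monos norm_surface_def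
  using assms by (simp_all add: power2_eq_square algebra_simps)

text \<open>The partials by \<open>y\<close> and \<open>z\<close> give \<open>y^2 = x z\<close> and
  \<open>c z^2 = x y\<close>. For \<open>z \<noteq> 0\<close> these imply
  \<open>x^2 = c y z\<close>, so the partial by \<open>x\<close> reduces to \<open>w x = 0\<close>;
  with \<open>3 w^2 + x^2 = 0\<close> everything vanishes.\<close>

lemma smooth_norm_surface:
  fixes c :: "'a::field_char_0"
  assumes c0: "c \<noteq> 0"
  shows "smooth_cubic_surface (norm_surface c)"
proof -
  have "False" if nz: "\<exists>i<4. x i \<noteq> 0" and P: "\<forall>m<4. cubic_partial to_ac (norm_surface c) m x = 0"
    for x :: "nat \<Rightarrow> 'a alg_closure"
  proof -
    note E =
      P[rule_format, of 0, unfolded cubic_partial_norm_surface[of to_ac, simplified], simplified]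
      P[rule_format, of "Suc 0", unfolded cubic_partial_norm_surface[of to_ac, simplified], simplified]
      P[rule_format, of 2, unfolded cubic_partial_norm_surface[of to_ac, simplified], simplified]
      P[rule_format, of 3, unfolded cubic_partial_norm_surface[of to_ac, simplified], simplified]
    define d where "d = to_ac c"
    have d: "d \<noteq> 0" using c0 by (simp add: d_def)
    define x0 where "x0 = x 0"
    define y0 where "y0 = x (Suc 0)"
    define z0 where "z0 = x 2"
    define w0 where "w0 = x 3"
    have e: "3 * x0 ^ 2 - 3 * d * y0 * z0 + 2 * w0 * x0 = 0" "3 * d * (y0 ^ 2 - x0 * z0) = 0"
      "3 * d * (d * z0 ^ 2 - x0 * y0) = 0" "3 * w0 ^ 2 + x0 ^ 2 = 0"
      using E by (simp_all add: x0_def y0_def z0_def w0_def d_def power2_eq_square algebra_simps)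
    hence yz: "y0 ^ 2 = x0 * z0" "d * z0 ^ 2 = x0 * y0" using d by simp_all
    have "w0 * x0 = 0"
    proof (cases "z0 = 0")
      case True
      hence "y0 = 0" using yz(1) by simp
      hence "x0 * (3 * x0 + 2 * w0) = 0" using e(1) by Groebner_Basis.algebra
      moreover have "x0 = 0" if "3 * x0 + 2 * w0 = 0"
      proof -
        \<comment> \<open>Eliminating \<open>w0\<close> gives
          \<open>27 x0^2 = 12 w0^2 = - 4 x0^2\<close>.\<close>
        have "31 * x0 ^ 2 = 0" using that e(4) by Groebner_Basis.algebra
        thus ?thesis by simp
      qed
      ultimately show ?thesis by auto
    next
      case False
      have "z0 * (x0 ^ 2 - d * y0 * z0) = 0" using yz by Groebner_Basis.algebra
      hence "x0 ^ 2 = d * y0 * z0" using False by simp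
      hence "2 * (w0 * x0) = 0" using e(1) by Groebner_Basis.algebra
      thus ?thesis by simp
    qed
    hence "w0 = 0" "x0 = 0" using e(4) by auto
    moreover from this have "y0 = 0" "z0 = 0" using yz d by simp_all
    ultimately show False using nz
      by (auto simp: less_Suc_eq numeral_eq_Suc x0_def y0_def z0_def w0_def)
  qed
  moreover have "(0, 0, 0) \<in> cubic_monos" "norm_surface c (0, 0, 0) \<noteq> 0"
    by (simp_all add: cubic_monos_def norm_surface_def)
  ultimately show ?thesis unfolding smooth_cubic_surface_def by blast
qed

text \<open>Every line has a rational point in the plane \<open>w = 0\<close>, where the surface has none.\<close>

lemma no_lines_norm_surface:
  fixes c :: "'a::field_char_0"
  assumes c: "\<And>a. a ^ 3 \<noteq> c"
  shows "\<not> line_on_surface (norm_surface c) L"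
proof
  assume on: "line_on_surface (norm_surface c) L"
  have no: "v4 x y z 0 \<notin> L" if "x \<noteq> 0 \<or> y \<noteq> 0 \<or> z \<noteq> 0" for x y z
  proof
    assume "v4 x y z 0 \<in> L"
    hence "cubic_eval id (norm_surface c) (v4 x y z 0) = 0"
      using on unfolding line_on_surface_iff by blast
    hence "x ^ 3 + c * y ^ 3 + c ^ 2 * z ^ 3 - 3 * c * x * y * z = 0"
      by (simp add: cubic_eval_norm_surface)
    from norm_form_anisotropic[OF this c] that show False by blast
  qed
  have "is_line L" using on unfolding line_on_surface_iff by blast
  thus False
  proof (cases rule: is_line_cases)
    case edge
    thus ?thesis using no[of 1 0 0] by (simp add: v4_mem_edge_line)
  next
    case (meets a b x y z w)
    have "v4 a b 0 0 = (\<lambda>i. 1 * v4 a b 0 0 i + 0 * v4 x y z w i)" by simp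
    hence "v4 a b 0 0 \<in> L" unfolding meets(3) span2_def by blast
    thus ?thesis using no[of a b 0] meets(1) by blast
  next
    case (graph \<alpha> \<beta> \<gamma> \<delta>)
    thus ?thesis using no[of \<alpha> \<gamma> 1] by (simp add: v4_mem_graph_line)
  qed
qed

text \<open>With coordinates \<open>z, w, x, y\<close> in this order, the plane
  \<open>x = m y\<close> through the edge cuts out the edge and the conic
  \<open>(m - m^3 / P) y^2 + (m - P) w^2 + z^2 = 0\<close>. This conic degenerates for
  \<open>m = 0\<close>, \<open>m = P\<close> and \<open>m^2 = P\<close>, and the residual conic in
  the plane \<open>y = 0\<close> is degenerate too.\<close>

definition one_line_surface :: "'a::field \<Rightarrow> nat \<times> nat \<times> nat \<Rightarrow> 'a" where
  "one_line_surface P = (\<lambda>_. 0)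
    ((2,3,3) := 1, (2,2,2) := - inverse P, (1,1,2) := 1, (0,0,3) := 1, (1,1,3) := - P)"

lemma cubic_eval_one_line_surface:
  assumes "phi 0 = 0" "phi 1 = 1" "phi (- P) = - phi P" "phi (- inverse P) = - phi (inverse P)"
  shows "cubic_eval phi (one_line_surface P) x = x 2 * x 3 ^ 2 - phi (inverse P) * x 2 ^ 3
    + x 2 * x 1 ^ 2 + x 3 * x 0 ^ 2 - phi P * x 3 * x 1 ^ 2"
  unfolding cubic_eval_def sum_cubic_monos one_line_surface_def
  using assms by (simp add: power2_eq_square power3_eq_cube algebra_simps)

lemma cubic_partial_one_line_surface:
  assumes "phi 0 = 0" "phi 1 = 1" "phi (- P) = - phi P" "phi (- inverse P) = - phi (inverse P)"
  shows "cubic_partial phi (one_line_surface P) 0 x = 2 * x 3 * x 0"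
    "cubic_partial phi (one_line_surface P) (Suc 0) x = 2 * x 2 * x 1 - 2 * phi P * x 3 * x 1"
    "cubic_partial phi (one_line_surface P) 2 x = x 3 ^ 2 - 3 * phi (inverse P) * x 2 ^ 2 + x 1 ^ 2"
    "cubic_partial phi (one_line_surface P) 3 x = 2 * x 2 * x 3 + x 0 ^ 2 - phi P * x 1 ^ 2"
  unfolding cubic_partial_def sum_cubic_monos one_line_surface_def
  using assms by (simp_all add: power2_eq_square algebra_simps)

lemma smooth_one_line_surface:
  fixes P :: "'a::field_char_0"
  assumes P: "P \<noteq> 0" "P \<noteq> 1"
  shows "smooth_cubic_surface (one_line_surface P)"
proof -
  have "False" if nz: "\<exists>i<4. x i \<noteq> 0" and D: "\<forall>m<4. cubic_partial to_ac (one_line_surface P) m x = 0"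
    for x :: "nat \<Rightarrow> 'a alg_closure"
  proof -
    note E =
      D[rule_format, of 0, unfolded cubic_partial_one_line_surface[of to_ac, simplified], simplified]
      D[rule_format, of "Suc 0", unfolded cubic_partial_one_line_surface[of to_ac, simplified], simplified]
      D[rule_format, of 2, unfolded cubic_partial_one_line_surface[of to_ac, simplified], simplified]
      D[rule_format, of 3, unfolded cubic_partial_one_line_surface[of to_ac, simplified], simplified]
    define d where "d = to_ac P"
    have d: "d \<noteq> 0" "d \<noteq> 1" using P by (simp_all add: d_def flip: to_ac_1)
    define z where "z = x 0"
    define w where "w = x (Suc 0)"
    define u where "u = x 2"
    define y where "y = x 3"
    have e: "y = 0 \<or> z = 0" "2 * w * (u - d * y) = 0" "y ^ 2 - 3 * inverse d * u ^ 2 + w ^ 2 = 0"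
      "2 * u * y + z ^ 2 - d * w ^ 2 = 0"
      using E by (simp_all add: z_def w_def u_def y_def d_def power2_eq_square algebra_simps)
    have e2: "w = 0 \<or> u = d * y" using e(2) by simp
    have "y = 0"
    proof (rule ccontr)
      assume y: "y \<noteq> 0"
      have z: "z = 0" using e(1) y by simp
      show False
      proof (cases "w = 0")
        case True
        thus False using e(3,4) z y by simp
      next
        case False
        hence u: "u = d * y" using e2 by simp
        have "d * (2 * y ^ 2 - w ^ 2) = 0" using e(4) unfolding z u by (simp add: power2_eq_square algebra_simps)
        hence w: "w ^ 2 = 2 * y ^ 2" using d by simp
        have "inverse d * (d * y) ^ 2 = d * y ^ 2" using d by (simp add: power2_eq_square)
        hence "y ^ 2 - 3 * d * y ^ 2 + w ^ 2 = 0" using e(3) unfolding u by (simp add: mult.assoc)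
        hence "3 * (y ^ 2 * (1 - d)) = 0" unfolding w by Groebner_Basis.algebra
        thus False using y d by simp
      qed
    qed
    moreover from this have "w = 0" using e2 e(3) by auto
    ultimately have "u = 0" "z = 0" using e(3,4) d by auto
    with \<open>y = 0\<close> \<open>w = 0\<close> show False using nz
      by (auto simp: less_Suc_eq numeral_eq_Suc z_def w_def u_def y_def)
  qed
  moreover have "(2, 3, 3) \<in> cubic_monos" "one_line_surface P (2, 3, 3) \<noteq> 0"
    by (simp_all add: cubic_monos_def one_line_surface_def)
  ultimately show ?thesis unfolding smooth_cubic_surface_def by blast
qed

text \<open>A line disjoint from the edge has a point with \<open>x = 1\<close>,
  \<open>y = 0\<close>, forcing \<open>1 / P\<close> to be a square. A line meeting the edge is a
  component of a degenerate residual conic, and none of these components is rational.\<close>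

lemma lines_one_line_surface:
  fixes P :: "'a::field_char_0"
  assumes sq: "\<And>a. a ^ 2 \<noteq> P" "\<And>a. a ^ 2 \<noteq> P * (P - 1)"
  shows "{L. line_on_surface (one_line_surface P) L} = {edge_line}"
proof -
  have P: "P \<noteq> 0" using sq(1)[of 0] by auto
  have sqi: "a ^ 2 \<noteq> inverse P" for a
    using sq(1)[of "inverse a"] by (metis inverse_inverse_eq power_inverse)
  have eval: "cubic_eval id (one_line_surface P) (v4 z w x y) =
    x * y ^ 2 - inverse P * x ^ 3 + x * w ^ 2 + y * z ^ 2 - P * y * w ^ 2" for x y z w
    by (simp add: cubic_eval_one_line_surface)
  have "line_on_surface (one_line_surface P) edge_line"
    using line_on_surface_v4[of "one_line_surface P" 1 0 0 0 0 1 0 0] is_line_edge_line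
    by (simp add: edge_line_def eval)
  moreover have "L = edge_line" if on: "line_on_surface (one_line_surface P) L" for L
  proof -
    have "is_line L" and F: "\<And>x. x \<in> L \<Longrightarrow> cubic_eval id (one_line_surface P) x = 0"
      using on unfolding line_on_surface_iff by blast+
    from this(1) show ?thesis
    proof (cases rule: is_line_cases)
      case (graph \<alpha> \<beta> \<gamma> \<delta>)
      have "v4 \<alpha> \<gamma> 1 0 \<in> L" unfolding graph v4_mem_graph_line by simp
      from F[OF this] have "\<gamma> ^ 2 = inverse P" by (simp add: eval)
      thus ?thesis using sqi by blast
    next
      case (meets a b z1 w1 x y)
      let ?d = "x * y ^ 2 - inverse P * x ^ 3 + x * w1 ^ 2 + y * z1 ^ 2 - P * y * w1 ^ 2"
      have "cubic_eval id (one_line_surface P)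
          (v4 (s * a + t * z1) (s * b + t * w1) (s * 0 + t * x) (s * 0 + t * y))
        = s ^ 3 * 0 + s ^ 2 * t * (x * b ^ 2 + y * a ^ 2 - P * y * b ^ 2)
          + s * t ^ 2 * (2 * (x * b * w1 + y * a * z1 - P * y * b * w1)) + t ^ 3 * ?d" for s t
        unfolding eval by (simp add: algebra_simps power2_eq_square power3_eq_cube)
      hence "\<forall>s t. s ^ 3 * 0 + s ^ 2 * t * (x * b ^ 2 + y * a ^ 2 - P * y * b ^ 2)
          + s * t ^ 2 * (2 * (x * b * w1 + y * a * z1 - P * y * b * w1)) + t ^ 3 * ?d = 0"
        using on unfolding meets(3) line_on_surface_v4 by simp
      hence e: "x * b ^ 2 + y * a ^ 2 - P * y * b ^ 2 = 0" "?d = 0"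
        unfolding binary_cubic_zero_iff by blast+
      have y: "y \<noteq> 0"
      proof
        assume y: "y = 0"
        have x: "x \<noteq> 0" using meets(2) y by simp
        have "x * (w1 ^ 2 - inverse P * x ^ 2) = 0"
          using e(2) y by (simp add: power2_eq_square power3_eq_cube algebra_simps)
        hence "(w1 / x) ^ 2 = inverse P" using x by (simp add: power_divide)
        thus False using sqi by blast
      qed
      have b: "b \<noteq> 0"
      proof
        assume "b = 0"
        thus False using e(1) y meets(1) by simp
      qed
      obtain s X0 Z0 where L: "L = meeting_line s X0 Z0"
        using meeting_line_eq[OF b y] meets(3) by blast
      have "cubic_eval id (one_line_surface P)
          (v4 (t * s + u * X0) (t * 1 + u * 0) (t * 0 + u * Z0) (t * 0 + u * 1))
        = t ^ 3 * 0 + t ^ 2 * u * (Z0 + s ^ 2 - P)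
          + t * u ^ 2 * (2 * (s * X0)) + u ^ 3 * (Z0 - inverse P * Z0 ^ 3 + X0 ^ 2)" for t u
        unfolding eval by (simp add: algebra_simps power2_eq_square power3_eq_cube)
      hence "\<forall>t u. t ^ 3 * 0 + t ^ 2 * u * (Z0 + s ^ 2 - P)
          + t * u ^ 2 * (2 * (s * X0)) + u ^ 3 * (Z0 - inverse P * Z0 ^ 3 + X0 ^ 2) = 0"
        using on unfolding L meeting_line_def line_on_surface_v4 by simp
      hence f: "Z0 + s ^ 2 - P = 0" "2 * (s * X0) = 0" "Z0 - inverse P * Z0 ^ 3 + X0 ^ 2 = 0"
        unfolding binary_cubic_zero_iff by blast+
      have f3: "P * Z0 - Z0 ^ 3 + P * X0 ^ 2 = 0"
      proof -
        have "P * (Z0 - inverse P * Z0 ^ 3 + X0 ^ 2) = P * Z0 - Z0 ^ 3 + P * X0 ^ 2"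
          using P by (simp add: algebra_simps)
        thus ?thesis unfolding f(3) by simp
      qed
      \<comment> \<open>The line lies in the plane \<open>x = Z0 y\<close>. If
        \<open>X0 = 0\<close>, then \<open>Z0 = 0\<close> and \<open>s^2 = P\<close>, or
        \<open>Z0^2 = P\<close>; if \<open>s = 0\<close>, then \<open>Z0 = P\<close> and
        \<open>X0^2 = P (P - 1)\<close>.\<close>
      from f(2) consider "X0 = 0" | "s = 0" by auto
      hence False
      proof cases
        case 1
        have "Z0 * (P - Z0 ^ 2) = 0" using f3 1 by (simp add: power2_eq_square power3_eq_cube algebra_simps)
        hence "Z0 = 0 \<or> Z0 ^ 2 = P" by auto
        thus False using f(1) sq(1) by auto
      next
        case 2
        hence Z0: "Z0 = P" using f(1) by simp
        have "P * (X0 ^ 2 - P * (P - 1)) = 0" using f3 unfolding Z0 by (simp add: power2_eq_square power3_eq_cube algebra_simps)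
        thus False using P sq(2) by simp
      qed
      thus ?thesis ..
    qed
  qed
  ultimately show ?thesis by blast
qed

text \<open>If \<open>P = a\<close> fails, then \<open>a (a - 1)\<close> is a square and
  \<open>P = 1 / a\<close> works: were \<open>P (P - 1) = (1 - a) / a^2\<close> a square, the
  quotient of \<open>a (a - 1)\<close> by \<open>1 - a\<close>, which is \<open>- a\<close>, would
  be one.\<close>

lemma exists_one_line_parameter:
  fixes a :: "'a::field"
  assumes "\<And>x. x ^ 2 \<noteq> a \<and> x ^ 2 \<noteq> - a"
  obtains P :: 'a where "\<And>x. x ^ 2 \<noteq> P" "\<And>x. x ^ 2 \<noteq> P * (P - 1)"
proof (cases "\<exists>x. x ^ 2 = a * (a - 1)")
  case False
  thus thesis using that[of a] assms by blast
next
  case True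
  then obtain b where b: "b ^ 2 = a * (a - 1)" by blast
  have a: "a \<noteq> 0" "a \<noteq> 1" using assms[of 0] assms[of 1] by auto
  have "x ^ 2 \<noteq> inverse a" for x
    using assms[of "inverse x"] by (metis inverse_inverse_eq power_inverse)
  moreover have "x ^ 2 \<noteq> inverse a * (inverse a - 1)" for x
  proof
    assume x: "x ^ 2 = inverse a * (inverse a - 1)"
    have "(x * a) ^ 2 = 1 - a"
      unfolding power_mult_distrib x using a by (simp add: power2_eq_square algebra_simps)
    moreover have "a * (a - 1) = - a * (1 - a)" by (simp add: algebra_simps)
    ultimately have "(b / (x * a)) ^ 2 = - a"
      unfolding power_divide b using a by simp
    thus False using assms by blast
  qed
  ultimately show thesis by (rule that)
qed

section \<open>Quadratic factors\<close>

definition quad_factors :: "'a::field poly \<Rightarrow> ('a \<times> 'a) set" where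
  "quad_factors p = {(h1, h0). [:h0, h1, 1:] dvd p}"

lemma quad_factors_iff: "(h1, h0) \<in> quad_factors p \<longleftrightarrow> [:h0, h1, 1:] dvd p"
  by (simp add: quad_factors_def)

definition factor_counts :: "'a::field poly \<Rightarrow> nat \<Rightarrow> nat \<Rightarrow> bool" where
  "factor_counts p R Q \<longleftrightarrow> finite {x. poly p x = 0} \<and> card {x. poly p x = 0} = R \<and>
     finite (quad_factors p) \<and> card (quad_factors p) = Q"

lemma linear_mult_cancel:
  assumes "[:- r, 1:] * a = [:- r, 1:] * (b :: 'a::field poly)"
  shows "a = b"
proof -
  have "[:- r, 1:] \<noteq> 0" by simp
  thus ?thesis using assms mult_left_cancel by blast
qed

text \<open>A monic quadratic factor either divides \<open>v\<close> or vanishes at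
  \<open>r\<close>; in the latter case it is \<open>(X - r) (X - s)\<close> with \<open>s\<close> a
  root of \<open>v\<close>.\<close>

lemma quad_factors_linear_mult:
  fixes v :: "'a::field poly"
  assumes v: "poly v r \<noteq> 0"
  shows "quad_factors ([:- r, 1:] * v) = quad_factors v \<union> (\<lambda>s. (- (r + s), r * s)) ` {s. poly v s = 0}"
proof (intro equalityI subsetI)
  fix h assume "h \<in> quad_factors ([:- r, 1:] * v)"
  then obtain h1 h0 where h: "h = (h1, h0)" and dvd: "[:h0, h1, 1:] dvd [:- r, 1:] * v"
    unfolding quad_factors_def by blast
  obtain k where k: "[:- r, 1:] * v = [:h0, h1, 1:] * k" using dvd by (rule dvdE)
  have "poly [:h0, h1, 1:] r * poly k r = 0"
    unfolding poly_mult[symmetric] k[symmetric] by simp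
  hence "poly [:h0, h1, 1:] r = 0 \<or> poly k r = 0" by simp
  thus "h \<in> quad_factors v \<union> (\<lambda>s. (- (r + s), r * s)) ` {s. poly v s = 0}"
  proof
    assume "poly [:h0, h1, 1:] r = 0"
    hence h0: "h0 = - r * (h1 + r)" by (simp add: eq_neg_iff_add_eq_0)
    have fac: "[:h0, h1, 1:] = [:- r, 1:] * [:h1 + r, 1:]" by (simp add: h0 algebra_simps)
    have "[:- r, 1:] * v = [:- r, 1:] * ([:h1 + r, 1:] * k)" using k unfolding fac by (simp only: mult.assoc)
    hence "v = [:h1 + r, 1:] * k" by (rule linear_mult_cancel)
    hence "poly v (- (h1 + r)) = 0" by (simp only: poly_mult) simp
    moreover have "h = (- (r + - (h1 + r)), r * - (h1 + r))" unfolding h h0 by (simp add: algebra_simps)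
    ultimately show ?thesis by blast
  next
    assume "poly k r = 0"
    then obtain k' where "k = [:- r, 1:] * k'" unfolding poly_eq_0_iff_dvd by (rule dvdE)
    hence "[:- r, 1:] * v = [:- r, 1:] * ([:h0, h1, 1:] * k')" using k by (simp only: mult.left_commute)
    hence "v = [:h0, h1, 1:] * k'" by (rule linear_mult_cancel)
    hence "[:h0, h1, 1:] dvd v" by (rule dvdI)
    thus ?thesis unfolding h by (intro UnI1) (simp only: quad_factors_iff)
  qed
next
  fix h assume "h \<in> quad_factors v \<union> (\<lambda>s. (- (r + s), r * s)) ` {s. poly v s = 0}"
  thus "h \<in> quad_factors ([:- r, 1:] * v)"
  proof
    assume "h \<in> quad_factors v"
    moreover obtain h1 h0 where "h = (h1, h0)" by fastforce
    ultimately show ?thesis by (simp only: quad_factors_iff dvd_mult)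
  next
    assume "h \<in> (\<lambda>s. (- (r + s), r * s)) ` {s. poly v s = 0}"
    then obtain s where s: "poly v s = 0" "h = (- (r + s), r * s)" by blast
    have "[:r * s, - (r + s), 1:] = [:- r, 1:] * [:- s, 1:]" by (simp add: algebra_simps)
    also have "\<dots> dvd [:- r, 1:] * v" using s(1) by (intro mult_dvd_mono) (simp_all add: poly_eq_0_iff_dvd)
    finally show ?thesis unfolding s(2) quad_factors_iff .
  qed
qed

lemma factor_counts_linear_mult:
  assumes "factor_counts v R Q" "poly v r \<noteq> 0"
  shows "factor_counts ([:- r, 1:] * v) (Suc R) (Q + R)"
proof -
  let ?f = "\<lambda>s. (- (r + s), r * s)"
  have roots: "{x. poly ([:- r, 1:] * v) x = 0} = insert r {x. poly v x = 0}" by auto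
  have "quad_factors v \<inter> ?f ` {s. poly v s = 0} = {}"
  proof (rule ccontr)
    assume "\<not> ?thesis"
    then obtain s where "[:r * s, - (r + s), 1:] dvd v" unfolding quad_factors_def by auto
    then obtain k where "v = [:r * s, - (r + s), 1:] * k" by (rule dvdE)
    hence "poly v r = 0" by (simp add: algebra_simps)
    thus False using assms(2) by simp
  qed
  moreover have "card (?f ` {s. poly v s = 0}) = card {s. poly v s = 0}"
    by (intro card_image inj_onI) simp
  ultimately show ?thesis
    using assms unfolding factor_counts_def roots quad_factors_linear_mult[OF assms(2)]
    by (simp add: card_Un_disjoint)
qed

lemma factor_counts_1: "factor_counts 1 0 0"
proof -
  have "quad_factors (1 :: 'a::field poly) = {}"
    by (auto simp: quad_factors_def is_unit_poly_iff)
  thus ?thesis by (simp add: factor_counts_def)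
qed

lemma quad_factors_quadratic: "quad_factors [:u0, u1, 1:] = {(u1, u0)}"
proof -
  have "h1 = u1 \<and> h0 = u0" if dvd: "[:h0, h1, 1:] dvd [:u0, u1, 1:]" for h1 h0
  proof -
    obtain k where k: "[:u0, u1, 1:] = [:h0, h1, 1:] * k" using dvd by (rule dvdE)
    have "k \<noteq> 0" using k by auto
    hence "degree [:u0, u1, 1:] = 2 + degree k" unfolding k by (subst degree_mult_eq) auto
    hence "degree k = 0" by simp
    then obtain a where "k = [:a:]" by (rule degree_eq_zeroE)
    with k show ?thesis by auto
  qed
  thus ?thesis unfolding quad_factors_def by auto
qed

lemma factor_counts_quadratic:
  assumes "\<And>x. poly [:u0, u1, 1:] x \<noteq> 0"
  shows "factor_counts [:u0, u1, 1:] 0 1"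
  using assms unfolding factor_counts_def quad_factors_quadratic by simp

lemma degree_one_has_root:
  assumes "degree (k :: 'a::field poly) = 1"
  shows "\<exists>x. poly k x = 0"
proof -
  obtain a k' where k: "k = pCons a k'" by (rule pCons_cases)
  have k': "k' \<noteq> 0" "degree k' = 0" using assms unfolding k by (auto split: if_splits)
  obtain b where b: "k' = [:b:]" using k'(2) by (rule degree_eq_zeroE)
  have "poly k (- a / b) = 0" using k'(1) unfolding k b by simp
  thus ?thesis by blast
qed

text \<open>The cofactor of a quadratic factor would be linear and have a root.\<close>

lemma factor_counts_cubic:
  assumes deg: "degree u = 3" and nr: "\<And>x. poly u x \<noteq> (0::'a::field)"
  shows "factor_counts u 0 0"
proof -
  have "\<not> [:h0, h1, 1:] dvd u" for h0 h1
  proof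
    assume "[:h0, h1, 1:] dvd u"
    then obtain k where k: "u = [:h0, h1, 1:] * k" by (rule dvdE)
    have "k \<noteq> 0" using k deg by auto
    hence "degree u = 2 + degree k" unfolding k by (subst degree_mult_eq) auto
    hence "degree k = 1" using deg by simp
    then obtain x where "poly k x = 0" using degree_one_has_root by blast
    hence "poly u x = 0" unfolding k poly_mult by simp
    thus False using nr by blast
  qed
  thus ?thesis using nr unfolding factor_counts_def quad_factors_def by simp
qed

lemma irreducible_quadratic:
  assumes nr: "\<And>x. poly [:h0, h1, 1:] x \<noteq> (0::'a::field)"
  shows "irreducible [:h0, h1, 1:]"
proof (rule irreducibleI)
  show "\<not> is_unit [:h0, h1, 1:]" by (auto simp: is_unit_poly_iff)
  fix a b assume ab: "[:h0, h1, 1:] = a * b"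
  have nz: "a \<noteq> 0" "b \<noteq> 0" using ab by auto
  have "degree [:h0, h1, 1:] = degree a + degree b" unfolding ab using nz by (simp add: degree_mult_eq)
  hence "degree a + degree b = 2" by simp
  moreover have "degree a \<noteq> 1"
    using degree_one_has_root[of a] nr unfolding ab poly_mult by (metis mult_zero_left)
  ultimately have "degree a = 0 \<or> degree b = 0" by linarith
  thus "is_unit a \<or> is_unit b" using nz by (auto simp: is_unit_iff_degree)
qed simp

text \<open>As the product has no roots, each of its quadratic factors is irreducible, hence prime,
  and divides \<open>u\<close> or \<open>v\<close>.\<close>

lemma factor_counts_mult:
  assumes u: "factor_counts u 0 Q" and v: "factor_counts v 0 Q'"
    and disj: "quad_factors u \<inter> quad_factors v = {}"
  shows "factor_counts (u * v) 0 (Q + Q')"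
proof -
  have nr: "poly (u * v) x \<noteq> 0" for x
    using u v unfolding factor_counts_def by (auto simp: card_eq_0_iff)
  have "quad_factors (u * v) \<subseteq> quad_factors u \<union> quad_factors v"
  proof
    fix h assume "h \<in> quad_factors (u * v)"
    then obtain h1 h0 where h: "h = (h1, h0)" and dvd: "[:h0, h1, 1:] dvd u * v"
      unfolding quad_factors_def by blast
    have "poly [:h0, h1, 1:] x \<noteq> 0" for x
      using nr[of x] dvd unfolding dvd_def by (metis mult_zero_left poly_mult)
    hence "prime_elem [:h0, h1, 1:]"
      by (intro field_poly_irreducible_imp_prime irreducible_quadratic)
    hence "[:h0, h1, 1:] dvd u \<or> [:h0, h1, 1:] dvd v" using dvd by (rule prime_elem_dvd_multD)
    thus "h \<in> quad_factors u \<union> quad_factors v" unfolding h quad_factors_def by auto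
  qed
  hence "quad_factors (u * v) = quad_factors u \<union> quad_factors v"
    unfolding quad_factors_def by auto
  thus ?thesis using u v disj nr unfolding factor_counts_def by (simp add: card_Un_disjoint)
qed

section \<open>The quintic as a polynomial\<close>

context quintic
begin

lemma quads_eq_quad_factors: "quads = quad_factors [:p0, p1, p2, p3, p4, 1:]"
proof -
  have "(h1, h0) \<in> quads \<longleftrightarrow> [:h0, h1, 1:] dvd [:p0, p1, p2, p3, p4, 1:]" for h1 h0
  proof
    assume "(h1, h0) \<in> quads"
    hence "p1 = h1 * g0 (h1, h0) + h0 * g1 (h1, h0)" "p0 = h0 * g0 (h1, h0)" by (auto simp: quads_def)
    moreover have "p4 = g2 (h1, h0) + h1" "p3 = g1 (h1, h0) + h0 + h1 * g2 (h1, h0)"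
      "p2 = g0 (h1, h0) + h1 * g1 (h1, h0) + h0 * g2 (h1, h0)"
      by (simp_all add: g0_def g1_def g2_def)
    ultimately have "[:p0, p1, p2, p3, p4, 1:] = [:h0, h1, 1:] * [:g0 (h1, h0), g1 (h1, h0), g2 (h1, h0), 1:]"
      by (simp add: algebra_simps)
    thus "[:h0, h1, 1:] dvd [:p0, p1, p2, p3, p4, 1:]" by (rule dvdI)
  next
    assume "[:h0, h1, 1:] dvd [:p0, p1, p2, p3, p4, 1:]"
    then obtain k where k: "[:p0, p1, p2, p3, p4, 1:] = [:h0, h1, 1:] * k" by (rule dvdE)
    have "k \<noteq> 0" using k by auto
    hence "degree [:p0, p1, p2, p3, p4, 1:] = 2 + degree k" unfolding k by (subst degree_mult_eq) auto
    hence deg: "degree k = 3" by simp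
    obtain a b c d k4 where k4: "k = pCons a (pCons b (pCons c (pCons d k4)))" by (metis pCons_cases)
    have "k4 = 0" using deg unfolding k4 by (auto split: if_splits)
    hence eqs: "p0 = h0 * a" "p1 = h0 * b + h1 * a" "p2 = h0 * c + h1 * b + a" "p3 = h0 * d + h1 * c + b"
      "p4 = h1 * d + c" "d = 1"
      using k unfolding k4 by (simp_all add: algebra_simps)
    have g2: "g2 (h1, h0) = c" unfolding g2_def prod.case using eqs(5,6) by simp
    have g1: "g1 (h1, h0) = b" unfolding g1_def prod.case g2 using eqs(4,6) by simp
    have g0: "g0 (h1, h0) = a" unfolding g0_def prod.case g1 g2 using eqs(3) by simp
    show "(h1, h0) \<in> quads" using eqs(1,2) unfolding quads_def mem_Collect_eq prod.case g0 g1 by (simp add: add.commute)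
  qed
  thus ?thesis unfolding quad_factors_def by auto
qed

lemma roots_eq: "roots = {x. poly [:p0, p1, p2, p3, p4, 1:] x = 0}"
  unfolding roots_def by (simp add: eval_nat_numeral algebra_simps)

end

text \<open>A common root \<open>r^2\<close> of \<open>C\<close> and \<open>D\<close> makes both
  \<open>r\<close> and \<open>- r\<close> roots of the quintic, so it can only be 0, and then 0 is a
  double root. The functions \<open>f\<close> and \<open>f'\<close> allow factored forms of the
  quintic and its derivative.\<close>

lemma quintic_intro:
  fixes p0 p1 p2 p3 p4 :: "'k::field_char_0" and f f' :: "'k alg_closure \<Rightarrow> 'k alg_closure"
  assumes f: "\<And>r. r ^ 5 + to_ac p4 * r ^ 4 + to_ac p3 * r ^ 3 + to_ac p2 * r ^ 2 + to_ac p1 * r + to_ac p0 = f r"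
    and f': "\<And>r. 5 * r ^ 4 + 4 * to_ac p4 * r ^ 3 + 3 * to_ac p3 * r ^ 2 + 2 * to_ac p2 * r + to_ac p1 = f' r"
    and simple: "\<And>r. f r = 0 \<Longrightarrow> f' r \<noteq> 0" and no_opposite: "\<And>r. f r = 0 \<Longrightarrow> f (- r) = 0 \<Longrightarrow> r = 0"
  shows "quintic p0 p1 p2 p3 p4"
proof
  fix z assume C: "z ^ 2 + to_ac p3 * z + to_ac p1 = 0"
  show "to_ac p4 * z ^ 2 + to_ac p2 * z + to_ac p0 \<noteq> 0"
  proof
    assume D: "to_ac p4 * z ^ 2 + to_ac p2 * z + to_ac p0 = 0"
    obtain r where r: "r ^ 2 = z" using nth_root_exists[of 2 z] by auto
    have "f r = 0" "f (- r) = 0"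
      using C D unfolding f[symmetric] r[symmetric] by Groebner_Basis.algebra+
    hence "r = 0" by (rule no_opposite)
    hence "z = 0" using r by simp
    hence "f 0 = 0" "f' 0 = 0" using C D f[of 0] f'[of 0] by simp_all
    thus False using simple by blast
  qed
qed (use f f' simple in auto)

lemma quintic_surface_card:
  fixes p0 p1 p2 p3 p4 :: "'k::field_char_0"
  assumes q: "quintic p0 p1 p2 p3 p4" and counts: "factor_counts [:p0, p1, p2, p3, p4, 1:] R Q"
    and n: "n = 2 + 3 * R + Q"
  shows "\<exists>c :: nat \<times> nat \<times> nat \<Rightarrow> 'k. smooth_cubic_surface c \<and>
    finite {L. line_on_surface c L} \<and> card {L. line_on_surface c L} = n"
proof -
  interpret quintic p0 p1 p2 p3 p4 by (rule q)
  have "finite roots" "finite quads" "card roots = R" "card quads = Q"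
    using counts unfolding factor_counts_def quads_eq_quad_factors roots_eq by auto
  thus ?thesis using smooth card_lines_on_S n by metis
qed

section \<open>The quintics\<close>

text \<open>Reducing \<open>r^3\<close> by the quadratic gives \<open>(p^2 - q) r = c - p q\<close>.
  So \<open>r\<close> is rational, or \<open>p^2 = q\<close> and \<open>c = p^3\<close>.\<close>

lemma cube_root_of_quadratic:
  fixes c p q :: "'a::field_char_0"
  assumes cube: "r ^ 3 = to_ac c" and quad: "r ^ 2 + to_ac p * r + to_ac q = 0"
  shows "\<exists>x. x ^ 3 = c"
proof (cases "p ^ 2 = q")
  case True
  have "r ^ 3 = to_ac (p ^ 3)"
    using quad unfolding True[symmetric] to_ac_power by Groebner_Basis.algebra
  thus ?thesis using cube unfolding to_ac_eq_iff by (metis to_ac_eq_iff)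
next
  case False
  have "to_ac (p ^ 2 - q) * r = to_ac (c - p * q)"
    using quad unfolding to_ac_diff to_ac_mult to_ac_power cube[symmetric] by Groebner_Basis.algebra
  hence "r = to_ac ((c - p * q) / (p ^ 2 - q))"
    using False by (simp add: nonzero_eq_divide_eq mult.commute flip: to_ac_power to_ac_diff)
  hence "to_ac (((c - p * q) / (p ^ 2 - q)) ^ 3) = to_ac c"
    using cube unfolding to_ac_power by simp
  thus ?thesis unfolding to_ac_eq_iff by blast
qed

lemma neg_diff_power2: "(- r - s) ^ 2 = (r + s) ^ (2::nat)" for r s :: "'a::comm_ring_1"
  by (simp add: power2_eq_square algebra_simps)

lemma to_ac_neq_nonsquare:
  assumes "\<And>x. x ^ 2 \<noteq> (a :: 'a::field)"
  shows "to_ac a \<noteq> to_ac x ^ 2"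
  using assms[of x] by (metis to_ac_eq_iff to_ac_power)

text \<open>The quintic \<open>X (X - 1) (X - 2) (X - 3) (X - 4)\<close>, with ten pairs of
  roots.\<close>

lemma exists_27_lines:
  "\<exists>c :: nat \<times> nat \<times> nat \<Rightarrow> 'k::field_char_0. smooth_cubic_surface c \<and>
    finite {L. line_on_surface c L} \<and> card {L. line_on_surface c L} = 27"
proof (rule quintic_surface_card)
  let ?f = "\<lambda>r :: 'k alg_closure. r * (r - 1) * (r - 2) * (r - 3) * (r - 4)"
  let ?f' = "\<lambda>r :: 'k alg_closure. 5 * r ^ 4 - 40 * r ^ 3 + 105 * r ^ 2 - 100 * r + 24"
  show "quintic (0::'k) 24 (- 50) 35 (- 10)"
  proof (rule quintic_intro)
    show "r ^ 5 + to_ac (- 10 :: 'k) * r ^ 4 + to_ac 35 * r ^ 3 + to_ac (- 50) * r ^ 2 + to_ac 24 * r + to_ac 0 = ?f r" for r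
      by (simp add: eval_nat_numeral algebra_simps)
    show "5 * r ^ 4 + 4 * to_ac (- 10 :: 'k) * r ^ 3 + 3 * to_ac 35 * r ^ 2 + 2 * to_ac (- 50) * r + to_ac 24 = ?f' r" for r
      by simp
    show "?f' r \<noteq> 0" if "?f r = 0" for r
      using that by (elim mult_eq_0_iff[THEN iffD1, elim_format] disjE) simp_all
    show "r = 0" if "?f r = 0" "?f (- r) = 0" for r
      using that(1) by (elim mult_eq_0_iff[THEN iffD1, elim_format] disjE) (use that(2) in simp_all)
  qed
  have eq: "[:0, 24, - 50, 35, - 10, 1:] = [:- 0, 1:] * ([:- 1, 1:] * ([:- 2, 1:] * ([:- 3, 1:] * ([:- 4, 1:] * (1 :: 'k poly)))))"
    by simp
  have counts: "factor_counts ([:- 0, 1:] * ([:- 1, 1:] * ([:- 2, 1:] * ([:- 3, 1:] * ([:- 4, 1:] * (1 :: 'k poly))))))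
    (Suc (Suc (Suc (Suc (Suc 0))))) (0 + 0 + Suc 0 + Suc (Suc 0) + Suc (Suc (Suc 0)) + Suc (Suc (Suc (Suc 0))))"
    by (intro factor_counts_linear_mult factor_counts_1) simp_all
  show "factor_counts [:0, 24, - 50, 35, - 10, 1 :: 'k:] 5 10"
    unfolding eq using counts by (simp add: eval_nat_numeral)
qed simp

text \<open>The quintic \<open>X (X - 1) (X - 2) ((X - 1)^2 - a)\<close>, with three roots and four
  quadratic factors.\<close>

lemma exists_15_lines:
  fixes a :: "'k::field_char_0"
  assumes a: "\<And>x. x ^ 2 \<noteq> a"
  shows "\<exists>c :: nat \<times> nat \<times> nat \<Rightarrow> 'k. smooth_cubic_surface c \<and>
    finite {L. line_on_surface c L} \<and> card {L. line_on_surface c L} = 15"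
proof (rule quintic_surface_card)
  let ?A = "to_ac a"
  let ?f = "\<lambda>r :: 'k alg_closure. ((r - 1) ^ 2 - ?A) * (r * (r - 1) * (r - 2))"
  let ?f' = "\<lambda>r :: 'k alg_closure. 2 * (r - 1) * (r * (r - 1) * (r - 2)) + ((r - 1) ^ 2 - ?A) * (3 * r ^ 2 - 6 * r + 2)"
  \<comment> \<open>The values of \<open>(r - 1)^2\<close> at 0, 1, 2 and their negatives, which
    must not be roots of the quadratic factor.\<close>
  have A: "?A \<noteq> 0" "?A \<noteq> 1" "?A \<noteq> 4" "?A \<noteq> 9"
    using to_ac_neq_nonsquare[OF a, of 0] to_ac_neq_nonsquare[OF a, of 1]
      to_ac_neq_nonsquare[OF a, of 2] to_ac_neq_nonsquare[OF a, of 3] by simp_all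
  show "quintic (0::'k) (2 - 2 * a) (- 7 + 3 * a) (9 - a) (- 5)"
  proof (rule quintic_intro)
    show "r ^ 5 + to_ac (- 5) * r ^ 4 + to_ac (9 - a) * r ^ 3 + to_ac (- 7 + 3 * a) * r ^ 2 + to_ac (2 - 2 * a) * r + to_ac 0 = ?f r" for r
      by (simp add: eval_nat_numeral algebra_simps)
    show "5 * r ^ 4 + 4 * to_ac (- 5) * r ^ 3 + 3 * to_ac (9 - a) * r ^ 2 + 2 * to_ac (- 7 + 3 * a) * r + to_ac (2 - 2 * a) = ?f' r" for r
      by (simp add: eval_nat_numeral algebra_simps)
    have roots: "(r - 1) ^ 2 = ?A \<or> r = 0 \<or> r = 1 \<or> r = 2" if "?f r = 0" for r
      using that by simp
    show "?f' r \<noteq> 0" if "?f r = 0" for r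
      using roots[OF that] A by (elim disjE) auto
    show "r = 0" if "?f r = 0" "?f (- r) = 0" for r
      using roots[OF that(1)]
    proof (elim disjE)
      assume r: "(r - 1) ^ 2 = ?A"
      from roots[OF that(2)] show "r = 0"
      proof (elim disjE)
        assume "(- r - 1) ^ 2 = ?A"
        hence "(r - 1) ^ 2 = (r + 1) ^ 2" using r by (simp add: neg_diff_power2)
        hence "4 * r = 0" by Groebner_Basis.algebra
        thus ?thesis by simp
      qed (use r A in \<open>auto simp: minus_equation_iff[of r]\<close>)
    qed (use roots[OF that(2)] A in auto)
  qed
  have eq: "[:0, 2 - 2 * a, - 7 + 3 * a, 9 - a, - 5, 1:] = [:- 0, 1:] * ([:- 1, 1:] * ([:- 2, 1:] * [:1 - a, - 2, 1:]))"
    by simp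
  have nr: "poly [:1 - a, - 2, 1:] x \<noteq> 0" for x
    using a[of "x - 1"] by (simp add: power2_eq_square algebra_simps)
  have counts: "factor_counts ([:- 0, 1:] * ([:- 1, 1:] * ([:- 2, 1:] * [:1 - a, - 2, 1:])))
    (Suc (Suc (Suc 0))) (1 + 0 + Suc 0 + Suc (Suc 0))"
    using nr[of 0] nr[of 1] nr[of 2]
    by (intro factor_counts_linear_mult factor_counts_quadratic nr) (simp_all only: poly_mult, simp_all)
  show "factor_counts [:0, 2 - 2 * a, - 7 + 3 * a, 9 - a, - 5, 1:] 3 4"
    unfolding eq using counts by (simp add: eval_nat_numeral)
qed simp

text \<open>The quintic \<open>X (X - 1) (X^3 - c)\<close>.\<close>

lemma exists_9_lines:
  fixes c :: "'k::field_char_0"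
  assumes c: "\<And>x. x ^ 3 \<noteq> c"
  shows "\<exists>c :: nat \<times> nat \<times> nat \<Rightarrow> 'k. smooth_cubic_surface c \<and>
    finite {L. line_on_surface c L} \<and> card {L. line_on_surface c L} = 9"
proof (rule quintic_surface_card)
  let ?C = "to_ac c"
  let ?f = "\<lambda>r :: 'k alg_closure. (r ^ 3 - ?C) * (r * (r - 1))"
  let ?f' = "\<lambda>r :: 'k alg_closure. 3 * r ^ 2 * (r * (r - 1)) + (r ^ 3 - ?C) * (2 * r - 1)"
  have "c \<noteq> 0" "c \<noteq> 1" "c \<noteq> - 1" using c[of 0] c[of 1] c[of "- 1"] by auto
  hence "to_ac c \<noteq> to_ac 0" "to_ac c \<noteq> to_ac 1" "to_ac c \<noteq> to_ac (- 1)" unfolding to_ac_eq_iff .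
  hence C: "?C \<noteq> 0" "?C \<noteq> 1" "?C \<noteq> - 1" by simp_all
  show "quintic (0::'k) c (- c) 0 (- 1)"
  proof (rule quintic_intro)
    show "r ^ 5 + to_ac (- 1) * r ^ 4 + to_ac 0 * r ^ 3 + to_ac (- c) * r ^ 2 + ?C * r + to_ac 0 = ?f r" for r
      by (simp add: eval_nat_numeral algebra_simps)
    show "5 * r ^ 4 + 4 * to_ac (- 1) * r ^ 3 + 3 * to_ac 0 * r ^ 2 + 2 * to_ac (- c) * r + ?C = ?f' r" for r
      by (simp add: eval_nat_numeral algebra_simps)
    have roots: "r ^ 3 = ?C \<or> r = 0 \<or> r = 1" if "?f r = 0" for r
      using that by simp
    show "?f' r \<noteq> 0" if "?f r = 0" for r
      using roots[OF that] C by (elim disjE) auto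
    show "r = 0" if "?f r = 0" "?f (- r) = 0" for r
      using roots[OF that(1)]
    proof (elim disjE)
      assume r: "r ^ 3 = ?C"
      from roots[OF that(2)] show "r = 0"
      proof (elim disjE)
        assume "(- r) ^ 3 = ?C"
        hence "- ?C = ?C" using r by simp
        thus ?thesis using C by simp
      qed (use r C in \<open>auto simp: minus_equation_iff[of r]\<close>)
    qed (use roots[OF that(2)] C in auto)
  qed
  have eq: "[:0, c, - c, 0, - 1, 1:] = [:- 0, 1:] * ([:- 1, 1:] * [:- c, 0, 0, 1:])"
    by simp
  have nr: "poly [:- c, 0, 0, 1:] x \<noteq> 0" for x
    using c[of x] by (simp add: power3_eq_cube algebra_simps)
  have counts: "factor_counts ([:- 0, 1:] * ([:- 1, 1:] * [:- c, 0, 0, 1:])) (Suc (Suc 0)) (0 + 0 + Suc 0)"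
    using nr[of 0] nr[of 1]
    by (intro factor_counts_linear_mult factor_counts_cubic nr) (simp_all only: poly_mult, simp_all)
  show "factor_counts [:0, c, - c, 0, - 1, 1:] 2 1"
    unfolding eq using counts by (simp add: eval_nat_numeral)
qed simp

text \<open>The quintic \<open>X ((X - 1)^2 - a) ((X - 2)^2 - a)\<close>.\<close>

lemma exists_7_lines:
  fixes a :: "'k::field_char_0"
  assumes a: "\<And>x. x ^ 2 \<noteq> a"
  shows "\<exists>c :: nat \<times> nat \<times> nat \<Rightarrow> 'k. smooth_cubic_surface c \<and>
    finite {L. line_on_surface c L} \<and> card {L. line_on_surface c L} = 7"
proof (rule quintic_surface_card)
  let ?A = "to_ac a"
  let ?f = "\<lambda>r :: 'k alg_closure. ((r - 1) ^ 2 - ?A) * ((r - 2) ^ 2 - ?A) * r"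
  let ?f' = "\<lambda>r :: 'k alg_closure. 2 * (r - 1) * ((r - 2) ^ 2 - ?A) * r
    + ((r - 1) ^ 2 - ?A) * (2 * (r - 2)) * r + ((r - 1) ^ 2 - ?A) * ((r - 2) ^ 2 - ?A)"
  have A: "?A \<noteq> 0" "?A \<noteq> 1" "?A \<noteq> 4" "4 * ?A \<noteq> 1" "4 * ?A \<noteq> 9"
    using to_ac_neq_nonsquare[OF a, of 0] to_ac_neq_nonsquare[OF a, of 1] to_ac_neq_nonsquare[OF a, of 2]
      to_ac_neq_nonsquare[OF a, of "1 / 2"] to_ac_neq_nonsquare[OF a, of "3 / 2"]
    by (simp_all add: power_divide field_simps)
  show "quintic (0::'k) ((1 - a) * (4 - a)) (- 12 + 6 * a) (13 - 2 * a) (- 6)"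
  proof (rule quintic_intro)
    show "r ^ 5 + to_ac (- 6) * r ^ 4 + to_ac (13 - 2 * a) * r ^ 3 + to_ac (- 12 + 6 * a) * r ^ 2
      + to_ac ((1 - a) * (4 - a)) * r + to_ac 0 = ?f r" for r
      by (simp add: eval_nat_numeral algebra_simps)
    show "5 * r ^ 4 + 4 * to_ac (- 6) * r ^ 3 + 3 * to_ac (13 - 2 * a) * r ^ 2 + 2 * to_ac (- 12 + 6 * a) * r
      + to_ac ((1 - a) * (4 - a)) = ?f' r" for r
      by (simp add: eval_nat_numeral algebra_simps)
    have roots: "(r - 1) ^ 2 = ?A \<or> (r - 2) ^ 2 = ?A \<or> r = 0" if "?f r = 0" for r
      using that by simp
    \<comment> \<open>A common root would be \<open>3 / 2\<close>, giving
      \<open>4 a = 1\<close>.\<close>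
    have distinct: "(r - 2) ^ 2 \<noteq> ?A" if r: "(r - 1) ^ 2 = ?A" for r
    proof
      assume "(r - 2) ^ 2 = ?A"
      hence "(r - 1) ^ 2 = (r - 2) ^ 2" using r by simp
      hence "4 * (r - 1) ^ 2 = 1" by Groebner_Basis.algebra
      thus False using A r by simp
    qed
    show "?f' r \<noteq> 0" if "?f r = 0" for r
      using roots[OF that]
    proof (elim disjE)
      assume r: "(r - 1) ^ 2 = ?A"
      have "r \<noteq> 0" "r \<noteq> 1" using r A by auto
      thus ?thesis using r distinct[OF r] by simp
    next
      assume r: "(r - 2) ^ 2 = ?A"
      have "r \<noteq> 0" "r \<noteq> 2" using r A by auto
      thus ?thesis using r distinct[of r] by auto
    qed (use A in simp)
    \<comment> \<open>Opposite roots of the two quadratics would force \<open>r = - 1 / 2\<close>,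
      giving \<open>4 a = 9\<close>.\<close>
    have no_sum_3: "(- r - 2) ^ 2 \<noteq> ?A" if r: "(r - 1) ^ 2 = ?A" for r
    proof
      assume "(- r - 2) ^ 2 = ?A"
      hence "(r - 1) ^ 2 = (r + 2) ^ 2" using r by (simp add: neg_diff_power2)
      hence "3 * (4 * (r - 1) ^ 2 - 9) = 0" by Groebner_Basis.algebra
      thus False using A r by simp
    qed
    show "r = 0" if "?f r = 0" "?f (- r) = 0" for r
    proof (rule ccontr)
      assume r0: "r \<noteq> 0"
      have "\<not> ((r - 1) ^ 2 = ?A \<and> (- r - 1) ^ 2 = ?A)"
      proof
        assume "(r - 1) ^ 2 = ?A \<and> (- r - 1) ^ 2 = ?A"
        hence "(r - 1) ^ 2 = (r + 1) ^ 2" by (simp add: neg_diff_power2)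
        hence "4 * r = 0" by Groebner_Basis.algebra
        thus False using r0 by simp
      qed
      moreover have "\<not> ((r - 2) ^ 2 = ?A \<and> (- r - 2) ^ 2 = ?A)"
      proof
        assume "(r - 2) ^ 2 = ?A \<and> (- r - 2) ^ 2 = ?A"
        hence "(r - 2) ^ 2 = (r + 2) ^ 2" by (simp add: neg_diff_power2)
        hence "8 * r = 0" by Groebner_Basis.algebra
        thus False using r0 by simp
      qed
      ultimately show False
        using roots[OF that(1)] roots[OF that(2)] r0 no_sum_3[of r] no_sum_3[of "- r"] by auto
    qed
  qed
  have eq: "[:0, (1 - a) * (4 - a), - 12 + 6 * a, 13 - 2 * a, - 6, 1:] = [:- 0, 1:] * ([:1 - a, - 2, 1:] * [:4 - a, - 4, 1:])"
    by (simp add: algebra_simps)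
  have nr: "poly [:1 - a, - 2, 1:] x \<noteq> 0" "poly [:4 - a, - 4, 1:] x \<noteq> 0" for x
    using a[of "x - 1"] a[of "x - 2"] by (simp_all add: power2_eq_square algebra_simps)
  have "factor_counts ([:1 - a, - 2, 1:] * [:4 - a, - 4, 1:]) 0 (1 + 1)"
    by (intro factor_counts_mult factor_counts_quadratic nr) (simp add: quad_factors_quadratic)
  hence counts: "factor_counts ([:- 0, 1:] * ([:1 - a, - 2, 1:] * [:4 - a, - 4, 1:])) (Suc 0) (1 + 1 + 0)"
    using nr[of 0] by (intro factor_counts_linear_mult) (simp_all only: poly_mult, simp_all)
  show "factor_counts [:0, (1 - a) * (4 - a), - 12 + 6 * a, 13 - 2 * a, - 6, 1:] 1 2"
    unfolding eq using counts by (simp add: eval_nat_numeral)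
qed simp

text \<open>A factorisation of \<open>Y^4 - a\<close> with \<open>Y = X - 1\<close> has the form
  \<open>(Y^2 + b Y + u) (Y^2 - b Y + v)\<close> with \<open>u + v = b^2\<close>,
  \<open>b (v - u) = 0\<close> and \<open>u v = - a\<close>. So \<open>u^2\<close> is
  \<open>a\<close> or \<open>- a\<close>.\<close>

lemma factor_counts_quartic:
  fixes a :: "'a::field_char_0"
  assumes a: "\<And>x. x ^ 2 \<noteq> a \<and> x ^ 2 \<noteq> - a"
  shows "factor_counts [:1 - a, - 4, 6, - 4, 1:] 0 0" (is "factor_counts ?p 0 0")
proof -
  have nr: "poly ?p x \<noteq> 0" for x
  proof
    assume "poly ?p x = 0"
    hence "((x - 1) ^ 2) ^ 2 = a" by (simp add: power2_eq_square algebra_simps)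
    thus False using a by blast
  qed
  have "\<not> [:h0, h1, 1:] dvd ?p" for h0 h1
  proof
    assume "[:h0, h1, 1:] dvd ?p"
    then obtain k where k: "?p = [:h0, h1, 1:] * k" by (rule dvdE)
    have "k \<noteq> 0" using k by auto
    hence "degree ?p = 2 + degree k" unfolding k by (subst degree_mult_eq) auto
    hence deg: "degree k = 2" by simp
    obtain k0 k1 k2 k3 where k3: "k = pCons k0 (pCons k1 (pCons k2 k3))" by (metis pCons_cases)
    have "k3 = 0" using deg unfolding k3 by (auto split: if_splits)
    hence "1 - a = h0 * k0 \<and> - 4 = h0 * k1 + h1 * k0 \<and> 6 = h0 * k2 + h1 * k1 + k0 \<and>
      - 4 = h1 * k2 + k1 \<and> k2 = 1"
      using k unfolding k3 by (auto simp: algebra_simps)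
    hence eqs: "1 - a = h0 * k0" "- 4 = h0 * k1 + h1 * k0" "6 = h0 * k2 + h1 * k1 + k0"
      "- 4 = h1 * k2 + k1" "k2 = 1" by blast+
    define b where "b = h1 + 2"
    define u where "u = h0 + h1 + 1"
    define v where "v = k0 + k1 + 1"
    have h: "h1 = b - 2" "h0 = u - b + 1" by (simp_all add: b_def u_def)
    have "k1 = - 4 - h1" using eqs(4,5) by (simp add: algebra_simps)
    hence kk: "k1 = - b - 2" "k0 = v + b + 1" by (simp_all add: b_def v_def)
    have sum: "u + v = b ^ 2"
      using eqs(3) unfolding eqs(5) h kk by Groebner_Basis.algebra
    have "b * (v - u) = 0"
      using eqs(2) sum unfolding h kk by Groebner_Basis.algebra
    moreover have uv: "- a = u * v"
      using eqs(1) sum calculation unfolding h kk by Groebner_Basis.algebra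
    ultimately consider "b = 0" | "u = v" by auto
    thus False
    proof cases
      case 1
      hence "v = - u" using sum by (simp add: add_eq_0_iff2)
      hence "u ^ 2 = a" using uv by (simp add: power2_eq_square)
      thus False using a by blast
    next
      case 2
      hence "u ^ 2 = - a" using uv by (simp add: power2_eq_square)
      thus False using a by blast
    qed
  qed
  thus ?thesis using nr unfolding factor_counts_def quad_factors_def by simp
qed

text \<open>The quintic \<open>X ((X - 1)^4 - a)\<close>.\<close>

lemma exists_5_lines:
  fixes a :: "'k::field_char_0"
  assumes a: "\<And>x. x ^ 2 \<noteq> a \<and> x ^ 2 \<noteq> - a"
  shows "\<exists>c :: nat \<times> nat \<times> nat \<Rightarrow> 'k. smooth_cubic_surface c \<and>
    finite {L. line_on_surface c L} \<and> card {L. line_on_surface c L} = 5"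
proof (rule quintic_surface_card)
  let ?A = "to_ac a"
  let ?f = "\<lambda>r :: 'k alg_closure. ((r - 1) ^ 4 - ?A) * r"
  let ?f' = "\<lambda>r :: 'k alg_closure. 4 * (r - 1) ^ 3 * r + ((r - 1) ^ 4 - ?A)"
  have A: "?A \<noteq> 0" "?A \<noteq> 1" "- ?A \<noteq> 4"
    using to_ac_neq_nonsquare[of a 0] to_ac_neq_nonsquare[of a 1] to_ac_neq_nonsquare[of "- a" 2] a
    by simp_all
  show "quintic (0::'k) (1 - a) (- 4) 6 (- 4)"
  proof (rule quintic_intro)
    show "r ^ 5 + to_ac (- 4) * r ^ 4 + to_ac 6 * r ^ 3 + to_ac (- 4) * r ^ 2 + to_ac (1 - a) * r + to_ac 0 = ?f r" for r
      by (simp add: eval_nat_numeral algebra_simps)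
    show "5 * r ^ 4 + 4 * to_ac (- 4) * r ^ 3 + 3 * to_ac 6 * r ^ 2 + 2 * to_ac (- 4) * r + to_ac (1 - a) = ?f' r" for r
      by (simp add: eval_nat_numeral algebra_simps)
    have roots: "(r - 1) ^ 4 = ?A \<or> r = 0" if "?f r = 0" for r
      using that by simp
    show "?f' r \<noteq> 0" if "?f r = 0" for r
      using roots[OF that]
    proof
      assume r: "(r - 1) ^ 4 = ?A"
      have "r \<noteq> 0" "r \<noteq> 1" using r A by auto
      thus ?thesis using r by simp
    qed (use A in simp)
    show "r = 0" if "?f r = 0" "?f (- r) = 0" for r
    proof (rule ccontr)
      assume r0: "r \<noteq> 0"
      hence r: "(r - 1) ^ 4 = ?A" "(- r - 1) ^ 4 = ?A" using roots[OF that(1)] roots[OF that(2)] by auto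
      \<comment> \<open>Nonzero opposite roots would satisfy \<open>r^2 = - 1\<close>, hence
        \<open>a = (r - 1)^4 = - 4\<close>, but \<open>- a\<close> is not a square.\<close>
      have "(- r - 1) ^ 4 - (r - 1) ^ 4 = 8 * r * (r ^ 2 + 1)"
        by (simp add: eval_nat_numeral algebra_simps)
      hence "8 * r * (r ^ 2 + 1) = 0" using r by simp
      hence r2: "r ^ 2 + 1 = 0" using r0 by simp
      hence "(r - 1) ^ 4 = - 4" by Groebner_Basis.algebra
      thus False using r(1) A by simp
    qed
  qed
  have eq: "[:0, 1 - a, - 4, 6, - 4, 1:] = [:- 0, 1:] * [:1 - a, - 4, 6, - 4, 1:]" by simp
  have counts: "factor_counts ([:- 0, 1:] * [:1 - a, - 4, 6, - 4, 1:]) (Suc 0) (0 + 0)"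
    by (intro factor_counts_linear_mult factor_counts_quartic a) (use a[of 1] in simp)
  show "factor_counts [:0, 1 - a, - 4, 6, - 4, 1:] 1 0"
    unfolding eq using counts by simp
qed simp

text \<open>The quintic \<open>(X^3 - c) ((X - 1)^2 - a)\<close>.\<close>

lemma exists_3_lines:
  fixes a c :: "'k::field_char_0"
  assumes a: "\<And>x. x ^ 2 \<noteq> a" and c: "\<And>x. x ^ 3 \<noteq> c"
  shows "\<exists>c :: nat \<times> nat \<times> nat \<Rightarrow> 'k. smooth_cubic_surface c \<and>
    finite {L. line_on_surface c L} \<and> card {L. line_on_surface c L} = 3"
proof (rule quintic_surface_card)
  let ?A = "to_ac a" and ?C = "to_ac c"
  let ?f = "\<lambda>r :: 'k alg_closure. (r ^ 3 - ?C) * ((r - 1) ^ 2 - ?A)"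
  let ?f' = "\<lambda>r :: 'k alg_closure. 3 * r ^ 2 * ((r - 1) ^ 2 - ?A) + (r ^ 3 - ?C) * (2 * (r - 1))"
  have A: "?A \<noteq> 0" using a[of 0] by auto
  have C: "?C \<noteq> 0" using c[of 0] by auto
  \<comment> \<open>Used with \<open>e = 1\<close> against common roots of the factors and with
    \<open>e = - 1\<close> against opposite ones.\<close>
  have no_common: "(r - to_ac e) ^ 2 \<noteq> ?A" if "r ^ 3 = ?C" for r e
  proof
    assume "(r - to_ac e) ^ 2 = ?A"
    hence "r ^ 2 + to_ac (- 2 * e) * r + to_ac (e ^ 2 - a) = 0"
      by (simp add: power2_eq_square algebra_simps)
    thus False using cube_root_of_quadratic[OF that] c by blast
  qed
  have no_common1: "(r - 1) ^ 2 \<noteq> ?A" "(r + 1) ^ 2 \<noteq> ?A" if "r ^ 3 = ?C" for r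
    using no_common[OF that, of 1] no_common[OF that, of "- 1"] by simp_all
  show "quintic (- c * (1 - a)) (2 * c) (- c) (1 - a) (- 2)"
  proof (rule quintic_intro)
    show "r ^ 5 + to_ac (- 2) * r ^ 4 + to_ac (1 - a) * r ^ 3 + to_ac (- c) * r ^ 2 + to_ac (2 * c) * r
      + to_ac (- c * (1 - a)) = ?f r" for r
      by (simp add: eval_nat_numeral algebra_simps)
    show "5 * r ^ 4 + 4 * to_ac (- 2) * r ^ 3 + 3 * to_ac (1 - a) * r ^ 2 + 2 * to_ac (- c) * r
      + to_ac (2 * c) = ?f' r" for r
      by (simp add: eval_nat_numeral algebra_simps)
    have roots: "r ^ 3 = ?C \<or> (r - 1) ^ 2 = ?A" if "?f r = 0" for r
      using that by simp
    show "?f' r \<noteq> 0" if "?f r = 0" for r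
      using roots[OF that]
    proof
      assume r: "r ^ 3 = ?C"
      have "r \<noteq> 0" using r C by auto
      thus ?thesis using r no_common1[OF r] by simp
    next
      assume r: "(r - 1) ^ 2 = ?A"
      have "r \<noteq> 1" using r A by auto
      thus ?thesis using r no_common1[of r] by auto
    qed
    show "r = 0" if "?f r = 0" "?f (- r) = 0" for r
      using roots[OF that(1)]
    proof
      assume r: "r ^ 3 = ?C"
      have "(- r) ^ 3 \<noteq> ?C" using r C by simp
      thus ?thesis using roots[OF that(2)] no_common1(2)[OF r] by (auto simp: neg_diff_power2)
    next
      assume r: "(r - 1) ^ 2 = ?A"
      have "(- r) ^ 3 \<noteq> ?C"
      proof
        assume "(- r) ^ 3 = ?C"
        from no_common1(2)[OF this] have "(- r + 1) ^ 2 \<noteq> ?A" .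
        moreover have "(- r + 1) ^ 2 = (r - 1) ^ 2" by (simp add: power2_eq_square algebra_simps)
        ultimately show False using r by simp
      qed
      hence "(r - 1) ^ 2 = (r + 1) ^ 2" using roots[OF that(2)] r by (simp add: neg_diff_power2)
      hence "4 * r = 0" by Groebner_Basis.algebra
      thus ?thesis by simp
    qed
  qed
  have eq: "[:- c * (1 - a), 2 * c, - c, 1 - a, - 2, 1:] = [:- c, 0, 0, 1:] * [:1 - a, - 2, 1:]"
    by (simp add: algebra_simps)
  have cubic: "factor_counts [:- c, 0, 0, 1:] 0 0"
  proof (rule factor_counts_cubic)
    show "poly [:- c, 0, 0, 1:] x \<noteq> 0" for x
      using c[of x] by (simp add: power3_eq_cube algebra_simps)
  qed simp
  have "quad_factors [:- c, 0, 0, 1:] = {}"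
    using cubic unfolding factor_counts_def by (metis card_0_eq)
  moreover have "factor_counts [:1 - a, - 2, 1:] 0 1"
  proof (rule factor_counts_quadratic)
    show "poly [:1 - a, - 2, 1:] x \<noteq> 0" for x
      using a[of "x - 1"] by (simp add: power2_eq_square algebra_simps)
  qed
  ultimately have "factor_counts ([:- c, 0, 0, 1:] * [:1 - a, - 2, 1:]) 0 (0 + 1)"
    by (intro factor_counts_mult cubic) auto
  thus "factor_counts [:- c * (1 - a), 2 * c, - c, 1 - a, - 2, 1:] 0 1"
    unfolding eq by (simp only: add_0_left)
qed simp

text \<open>The quintic \<open>X^5 - c\<close>, which has no quadratic factor: the constant term
  \<open>h0\<close> of one would satisfy \<open>h0^5 = c^2\<close>, making \<open>h0^3 / c\<close> a
  fifth root of \<open>c\<close>.\<close>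

lemma exists_2_lines:
  fixes c :: "'k::field_char_0"
  assumes c: "\<And>x. x ^ 5 \<noteq> c"
  shows "\<exists>c :: nat \<times> nat \<times> nat \<Rightarrow> 'k. smooth_cubic_surface c \<and>
    finite {L. line_on_surface c L} \<and> card {L. line_on_surface c L} = 2"
proof (rule quintic_surface_card)
  have c0: "c \<noteq> 0" using c[of 0] by auto
  show q: "quintic (- c) 0 0 0 0"
    by (rule quintic_intro[of _ _ _ _ _ "\<lambda>r. r ^ 5 - to_ac c" "\<lambda>r. 5 * r ^ 4"])
      (use c0 in \<open>auto simp: power_0_left\<close>)
  interpret quintic "- c" 0 0 0 0 by (rule q)
  have "h \<notin> quads" for h
  proof
    assume h: "h \<in> quads"
    obtain h1 h0 where "h = (h1, h0)" by fastforce
    with h have e: "h1 * (2 * h0 * h1 - h1 ^ 3) + h0 * (h1 ^ 2 - h0) = 0" "c = - h0 * (2 * h0 * h1 - h1 ^ 3)"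
      unfolding quads_def by (simp_all add: g0_def g1_def g2_def eval_nat_numeral algebra_simps)
    have "h0 ^ 5 = c ^ 2" using e(1) unfolding e(2) by Groebner_Basis.algebra
    hence "(h0 ^ 3 / c) ^ 5 = c"
      using c0 by (simp add: power_divide eval_nat_numeral field_simps)
    thus False using c by blast
  qed
  moreover have "s \<notin> roots" for s using c[of s] by (simp add: roots_def)
  ultimately have "roots = {}" "quads = {}" by blast+
  thus "factor_counts [:- c, 0, 0, 0, 0, 1:] 0 0"
    unfolding roots_eq quads_eq_quad_factors factor_counts_def by simp
qed simp

theorem theorem1p3:
  assumes "finitely_generated_field TYPE('k::field_char_0)
           \<or> finite_transcendental_extension TYPE('k)"
    and "n \<in> {0, 1, 2, 3, 5, 7, 9, 15, 27::nat}"
  shows "\<exists>c :: nat \<times> nat \<times> nat \<Rightarrow> 'k. smooth_cubic_surface c \<and>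
           finite {L. line_on_surface c L} \<and> card {L. line_on_surface c L} = n"
proof -
  note non_power = exists_non_power_up_to_sign[OF assms(1)]
  obtain a :: 'k where a: "\<And>x. x ^ 2 \<noteq> a \<and> x ^ 2 \<noteq> - a" using non_power[of 2] by auto
  obtain b :: 'k where b: "\<And>x. x ^ 3 \<noteq> b" using non_power[of 3] by auto
  obtain d :: 'k where d: "\<And>x. x ^ 5 \<noteq> d" using non_power[of 5] by auto
  have "b \<noteq> 0" using b[of 0] by auto
  hence zero: ?thesis if "n = 0"
    using smooth_norm_surface no_lines_norm_surface[OF b] that by (intro exI[of _ "norm_surface b"]) simp
  obtain P :: 'k where P: "\<And>x. x ^ 2 \<noteq> P" "\<And>x. x ^ 2 \<noteq> P * (P - 1)"
    using exists_one_line_parameter[OF a] by blast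
  have "P \<noteq> 0" "P \<noteq> 1" using P(1)[of 0] P(1)[of 1] by auto
  hence one: ?thesis if "n = 1"
    using smooth_one_line_surface lines_one_line_surface[OF P] that
    by (intro exI[of _ "one_line_surface P"]) simp
  have sq: "\<And>x. x ^ 2 \<noteq> a" using a by blast
  show ?thesis
    using assms(2) zero one exists_2_lines[OF d] exists_3_lines[OF sq b] exists_5_lines[OF a]
      exists_7_lines[OF sq] exists_9_lines[OF b] exists_15_lines[OF sq] exists_27_lines[where 'k='k]
    by (elim insertE emptyE) simp_all
qed

end
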